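(* For all $m,n\ge0$, $H^k_{dR,c}(\mathbb R^{m|n})\cong\mathbb R$ if $k=m$ and $H^k_{dR,c}(\mathbb R^{m|n})=0$ if $k\neq m$. The nonzero group $H^m_{dR,c}(\mathbb R^{m|n})$ is spanned by the class of $\mathcal B_m(x_1,\dots,x_m)\,dx_1\cdots dx_m$, where $\mathcal B_m$ is a compactly supported bump function on $\mathbb R^m$ with $\int_{\mathbb R^m}\mathcal B_m=1$.
   Context: $\mathbb R^{m|n}$ is the superdomain with even coordinates $x_1,\dots,x_m$ and odd coordinates $\theta_1,\dots,\theta_n$. Its de Rham complex is the exterior algebra of $1$-forms generated by $dx_i$ (anticommuting) and $d\theta_\alpha$ (commuting, of odd parity), with the usual exterior derivative; it is unbounded above when $n\ge1$. $H^k_{dR,c}$ denotes the cohomology of the complex of compactly supported forms. *)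

theory Defs
  imports "HOL-Analysis.Analysis"
begin

text \<open>Points of R^m are encoded as functions nat => real vanishing at indices >= m.
  Even coordinates x_0..x_(m-1), odd coordinates theta_0..theta_(n-1).\<close>

definition pts :: "nat \<Rightarrow> (nat \<Rightarrow> real) set" where
  "pts m = {x. \<forall>i\<ge>m. x i = 0}"

definition trunc :: "nat \<Rightarrow> (nat \<Rightarrow> real) \<Rightarrow> (nat \<Rightarrow> real)" where
  "trunc m x = (\<lambda>i. if i < m then x i else 0)"

definition partial :: "nat \<Rightarrow> ((nat \<Rightarrow> real) \<Rightarrow> real) \<Rightarrow> (nat \<Rightarrow> real) \<Rightarrow> real" where
  "partial i f = (\<lambda>x. deriv (\<lambda>t. f (x(i := t))) (x i))"

fun iter_partial :: "nat list \<Rightarrow> ((nat \<Rightarrow> real) \<Rightarrow> real) \<Rightarrow> (nat \<Rightarrow> real) \<Rightarrow> real" where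
  "iter_partial [] f = f"
| "iter_partial (i # is) f = partial i (iter_partial is f)"

text \<open>Smooth (C^infinity) functions on R^m: f depends only on the first m coordinates and all
  iterated partial derivatives exist everywhere and are continuous on R^m (the subspace
  topology of pts m in the product topology is the Euclidean topology).\<close>
definition smooth :: "nat \<Rightarrow> ((nat \<Rightarrow> real) \<Rightarrow> real) \<Rightarrow> bool" where
  "smooth m f \<longleftrightarrow> (\<forall>x. f x = f (trunc m x)) \<and>
     (\<forall>is. set is \<subseteq> {..<m} \<longrightarrow>
        continuous_on (pts m) (iter_partial is f) \<and>
        (\<forall>x i. i < m \<longrightarrow> (\<lambda>t. iter_partial is f (x(i := t))) differentiable (at (x i))))"

definition csupp :: "nat \<Rightarrow> ((nat \<Rightarrow> real) \<Rightarrow> real) \<Rightarrow> bool" where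
  "csupp m f \<longleftrightarrow> (\<exists>R. \<forall>x\<in>pts m. f x \<noteq> 0 \<longrightarrow> (\<forall>i<m. \<bar>x i\<bar> \<le> R))"

text \<open>A differential form on R^(m|n) is a family of coefficients c I J b, standing for
  sum of  c I J b (x) * theta^I * dx^J * dtheta^b,  where theta^I and dx^J are products in
  increasing index order and dtheta^b is the monomial with exponent vector b.\<close>
type_synonym sform = "nat set \<Rightarrow> nat set \<Rightarrow> (nat \<Rightarrow> nat) \<Rightarrow> (nat \<Rightarrow> real) \<Rightarrow> real"

definition valid_idx :: "nat \<Rightarrow> nat \<Rightarrow> nat set \<Rightarrow> nat set \<Rightarrow> (nat \<Rightarrow> nat) \<Rightarrow> bool" where
  "valid_idx m n I J b \<longleftrightarrow> I \<subseteq> {..<n} \<and> J \<subseteq> {..<m} \<and> (\<forall>a\<ge>n. b a = 0)"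

definition fdeg :: "nat \<Rightarrow> nat set \<Rightarrow> (nat \<Rightarrow> nat) \<Rightarrow> nat" where
  "fdeg n J b = card J + (\<Sum>a<n. b a)"

definition cform :: "nat \<Rightarrow> nat \<Rightarrow> nat \<Rightarrow> sform \<Rightarrow> bool" where
  "cform m n k c \<longleftrightarrow>
     (\<forall>I J b. c I J b \<noteq> (\<lambda>x. 0) \<longrightarrow> valid_idx m n I J b \<and> fdeg n J b = k) \<and>
     (\<forall>I J b. smooth m (c I J b) \<and> csupp m (c I J b))"

text \<open>Exterior derivative d = sum dx_i d/dx_i + sum dtheta_a d/dtheta_a, the odd derivation of
  the supercommutative algebra generated by x (even), theta (odd), dx (odd), dtheta (even)
  with d x_i = dx_i, d theta_a = dtheta_a.\<close>
definition dform :: "nat \<Rightarrow> nat \<Rightarrow> sform \<Rightarrow> sform" where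
  "dform m n c = (\<lambda>I J b x.
     if valid_idx m n I J b then
       (\<Sum>i\<in>J. (-1) ^ (card I + card {j\<in>J. j < i}) * partial i (c I (J - {i}) b) x)
       + (\<Sum>a\<in>{a. a < n \<and> a \<notin> I \<and> 0 < b a}.
            (-1) ^ card {e\<in>I. e < a} * c (insert a I) J (b(a := b a - 1)) x)
     else 0)"

definition closed_form :: "nat \<Rightarrow> nat \<Rightarrow> sform \<Rightarrow> bool" where
  "closed_form m n c \<longleftrightarrow> dform m n c = (\<lambda>I J b x. 0)"

definition exact_form :: "nat \<Rightarrow> nat \<Rightarrow> nat \<Rightarrow> sform \<Rightarrow> bool" where
  "exact_form m n k c \<longleftrightarrow>
     (k = 0 \<and> c = (\<lambda>I J b x. 0)) \<or> (0 < k \<and> (\<exists>e. cform m n (k - 1) e \<and> dform m n e = c))"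

definition top_form :: "nat \<Rightarrow> ((nat \<Rightarrow> real) \<Rightarrow> real) \<Rightarrow> sform" where
  "top_form m f = (\<lambda>I J b. if I = {} \<and> J = {..<m} \<and> b = (\<lambda>_. 0) then f else (\<lambda>x. 0))"

definition integral_Rm :: "nat \<Rightarrow> ((nat \<Rightarrow> real) \<Rightarrow> real) \<Rightarrow> real" where
  "integral_Rm m f = integral\<^sup>L (PiM {..<m} (\<lambda>_. lborel)) (\<lambda>y. f (trunc m y))"

end

theory Submission
  imports Defs
begin

text \<open>Both reductions are chain homotopies. In the odd directions the complex is a Koszul complex:
  \<open>h = \<Sum>\<^sub>a \<theta>\<^sub>a \<partial>/\<partial>(d\<theta>\<^sub>a)\<close> satisfies \<open>d h + h d = |I| + |b|\<close> on the component \<open>\<theta>^I dx^J d\<theta>^b\<close>, so a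
  closed form is cohomologous to its part free of \<open>\<theta>\<close> and \<open>d\<theta>\<close>, a classical compactly supported
  form on \<open>R^m\<close>. In an even direction \<open>x_i\<close>, contraction with the antiderivative of
  \<open>f - e_i \<integral> f dx_i\<close> is a homotopy between the identity and the projection
  \<open>f dx^J \<mapsto> e_i (\<integral> f dx_i) dx^J\<close> for \<open>i \<in> J\<close>, and \<open>0\<close> for \<open>i \<notin> J\<close>. Applying
  this in every coordinate leaves only the top component, multiplied by its integral. The bumps
  \<open>e_i\<close> need not be constructed: integrating \<open>B\<close> over all coordinates but \<open>x_i\<close> gives one.\<close>

section \<open>Smooth functions\<close>

text \<open>Both homotopies are applied to closed forms only, so the term containing the
  differential of the form drops out and each identity reads d h w = w - (projection of w).
  Iterating the even projections leaves the product of the \<open>e i\<close> times the full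
  integral, and this product may differ from \<open>B\<close>. The two are never compared: exactness
  is shown for forms of total integral 0 and applied to w - r B, where r is the integral of the top
  coefficient free of theta and dtheta. Conversely \<open>B\<close> is not exact because the
  integral kills derivatives (Stokes). All integrals run over one fixed interval {-R..R}. After the
  odd reduction only one coefficient per \<open>J\<close> remains, hence finitely many, so a single
  radius serves the form and \<open>B\<close>; projections and homotopies preserve it. Lebesgue
  integration enters only when iterated integrals are identified with \<open>integral_Rm\<close>.
  The analytic obstacle is smoothness of parameter integrals: instead of computing iterated
  partials, one exhibits a class of functions closed under \<open>partial\<close>.\<close>

lemma iter_partial_snoc: "iter_partial (is @ [i]) f = iter_partial is (partial i f)"
  by (induction "is") auto

lemma trunc_upd: "i < m \<Longrightarrow> trunc m (x(i := t)) = (trunc m x)(i := t)"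
  by (auto simp: trunc_def)

lemma continuous_on_trunc: "continuous_on UNIV (trunc m)"
proof (rule continuous_on_coordinatewise_then_product)
  show "continuous_on UNIV (\<lambda>x. trunc m x i)" for i
    by (cases "i < m") (simp_all add: trunc_def continuous_on_product_coordinates)
qed

lemma trunc_in_pts: "trunc m x \<in> pts m"
  by (simp add: trunc_def pts_def)

text \<open>Smoothness is the largest class of continuous, partially differentiable functions
  factoring through \<open>trunc m\<close> that is closed under \<open>partial\<close>, so any such
  class \<open>P\<close> consists of smooth functions.\<close>

lemma smooth_coinduct [consumes 1, case_names trunc cont differentiable step]:
  assumes "P f"
    and tr: "\<And>f x. P f \<Longrightarrow> f x = f (trunc m x)"
    and co: "\<And>f. P f \<Longrightarrow> continuous_on (pts m) f"
    and di: "\<And>f i x. P f \<Longrightarrow> i < m \<Longrightarrow> (\<lambda>t. f (x(i := t))) differentiable (at (x i))"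
    and st: "\<And>f i. P f \<Longrightarrow> i < m \<Longrightarrow> P (partial i f)"
  shows "smooth m f"
proof -
  \<comment> \<open>The last list entry is the innermost derivative. Peeling it off replaces
    \<open>f\<close> by \<open>partial i f\<close>, which is why \<open>f\<close> is
    quantified.\<close>
  have "\<forall>f. P f \<longrightarrow> set is \<subseteq> {..<m} \<longrightarrow>
      P (iter_partial is f)" for "is"
    by (induction "is" rule: rev_induct) (auto simp: iter_partial_snoc st)
  then have "P (iter_partial is f)" if "set is \<subseteq> {..<m}" for "is"
    using that \<open>P f\<close> by simp
  then show ?thesis
    unfolding smooth_def using tr[OF \<open>P f\<close>] by (auto intro: co di)
qed

lemma smooth_trunc: "smooth m f \<Longrightarrow> f (trunc m x) = f x"
  by (simp add: smooth_def)

lemma partial_trunc: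
  assumes "\<And>x. f (trunc m x) = f x" "i < m"
  shows "partial i f (trunc m x) = partial i f x"
proof -
  have "f ((trunc m x)(i := t)) = f (x(i := t))" for t
    using assms(1)[of "x(i := t)"] trunc_upd[OF assms(2)] by simp
  moreover have "trunc m x i = x i" using assms(2) by (simp add: trunc_def)
  ultimately show ?thesis by (simp add: partial_def)
qed

lemma smooth_partial:
  assumes "smooth m f" "i < m"
  shows "smooth m (partial i f)"
proof -
  have "\<forall>x. partial i f x = partial i f (trunc m x)"
    using partial_trunc[of f m i] smooth_trunc[OF assms(1)] assms(2) by simp
  moreover have "iter_partial is (partial i f) = iter_partial (is @ [i]) f" for "is"
    by (simp add: iter_partial_snoc)
  ultimately show ?thesis
    using assms unfolding smooth_def by auto
qed

text \<open>Since f factors through the continuous map \<open>trunc m\<close>, continuity on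
  \<open>pts m\<close> lifts to the whole product space; continuity is used in that form from here
  on.\<close>

lemma smooth_continuous:
  assumes "smooth m f"
  shows "continuous_on S f"
proof -
  have "continuous_on (pts m) (iter_partial [] f)"
    using assms unfolding smooth_def by (elim conjE allE[of _ "[]"]) simp
  then have "continuous_on UNIV (\<lambda>x. f (trunc m x))"
    by (intro continuous_on_compose2[OF _ continuous_on_trunc]) (auto simp: trunc_in_pts)
  then have "continuous_on UNIV f"
    by (simp add: smooth_trunc[OF assms])
  then show ?thesis
    by (rule continuous_on_subset) simp
qed

lemma smooth_DERIV:
  assumes "smooth m f" "i < m"
  shows "((\<lambda>t. f (x(i := t))) has_real_derivative partial i f (x(i := s))) (at s)"
proof -
  let ?y = "x(i := s)"
  have "\<forall>x i. i < m \<longrightarrow> (\<lambda>t. iter_partial [] f (x(i := t))) differentiable (at (x i))"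
    using assms unfolding smooth_def by (elim conjE allE[of _ "[]"]) simp
  then have "(\<lambda>t. iter_partial [] f (?y(i := t))) differentiable (at (?y i))"
    using assms(2) by blast
  then have "(\<lambda>t. f (x(i := t))) differentiable (at s)"
    by simp
  then show ?thesis
    by (simp add: partial_def DERIV_deriv_iff_real_differentiable)
qed

lemma smooth_DERIV':
  assumes "smooth m f" "i < m"
  shows "((\<lambda>t. f (x(i := t))) has_real_derivative partial i f x) (at (x i))"
  using smooth_DERIV[OF assms, of x "x i"] by simp

lemma partial_eqI:
  assumes "((\<lambda>t. f (x(i := t))) has_real_derivative D) (at (x i))"
  shows "partial i f x = D"
  using assms by (simp add: partial_def DERIV_imp_deriv)

lemma partial_const: "partial i (\<lambda>x. c) = (\<lambda>x. 0)"
  by (auto simp: partial_def)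

lemma partial_add:
  assumes "smooth m f" "smooth m g" "i < m"
  shows "partial i (\<lambda>x. f x + g x) = (\<lambda>x. partial i f x + partial i g x)"
  by (intro ext partial_eqI derivative_intros smooth_DERIV'[OF assms(1,3)] smooth_DERIV'[OF assms(2,3)])

lemma partial_cmult:
  assumes "smooth m f" "i < m"
  shows "partial i (\<lambda>x. c * f x) = (\<lambda>x. c * partial i f x)"
  using DERIV_cmult[OF smooth_DERIV'[OF assms]] by (intro ext partial_eqI) auto

lemma partial_mult:
  assumes "smooth m f" "smooth m g" "i < m"
  shows "partial i (\<lambda>x. f x * g x) = (\<lambda>x. partial i f x * g x + partial i g x * f x)"
proof (intro ext partial_eqI)
  fix x
  show "((\<lambda>t. f (x(i := t)) * g (x(i := t))) has_real_derivative
      partial i f x * g x + partial i g x * f x) (at (x i))"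
    using DERIV_mult[OF smooth_DERIV'[OF assms(1,3), of x] smooth_DERIV'[OF assms(2,3), of x]] by simp
qed

lemma smooth_differentiable:
  assumes "smooth m f" "i < m"
  shows "(\<lambda>t. f (x(i := t))) differentiable (at (x i))"
  using smooth_DERIV'[OF assms] real_differentiable_def by blast

lemma smooth_const: "smooth m (\<lambda>x. c)"
proof -
  have "\<exists>d. (\<lambda>x. c) = (\<lambda>x::nat \<Rightarrow> real. d)" by blast
  then show ?thesis
    by (rule smooth_coinduct[where P = "\<lambda>f. \<exists>d. f = (\<lambda>x. d)"]) (auto simp: partial_const)
qed

lemma smooth_add:
  assumes "smooth m f" "smooth m g"
  shows "smooth m (\<lambda>x. f x + g x)"
proof -
  let ?P = "\<lambda>h. \<exists>f g. h = (\<lambda>x. f x + g x) \<and> smooth m f \<and> smooth m g"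
  have "?P (\<lambda>x. f x + g x)"
    using assms by blast
  then show ?thesis
  proof (rule smooth_coinduct[where P = ?P], goal_cases)
    case (1 f x) then show ?case by (auto simp: smooth_trunc)
  next
    case (2 f) then show ?case by (auto intro!: continuous_on_add intro: smooth_continuous)
  next
    case (3 f i x) then show ?case by (auto intro: differentiable_add smooth_differentiable)
  next
    case (4 f i) then show ?case using partial_add smooth_partial by blast
  qed
qed

lemma smooth_sum:
  assumes "\<And>i. i \<in> A \<Longrightarrow> smooth m (f i)"
  shows "smooth m (\<lambda>x. \<Sum>i\<in>A. f i x)"
proof (cases "finite A")
  case True
  then show ?thesis using assms
    by induction (auto intro: smooth_const smooth_add)
qed (simp add: smooth_const)

text \<open>Products are not closed under partial derivatives, so the coinduction runs on their sums.\<close>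

inductive prod_span :: "nat \<Rightarrow> ((nat \<Rightarrow> real) \<Rightarrow> real) \<Rightarrow> bool" for m where
  "smooth m f \<Longrightarrow> smooth m g \<Longrightarrow> prod_span m (\<lambda>x. f x * g x)"
| "prod_span m f \<Longrightarrow> prod_span m g \<Longrightarrow> prod_span m (\<lambda>x. f x + g x)"

text \<open>Existence of the derivative and its membership in the span are proved together: for a
  sum, differentiability of the summands is known from the induction only.\<close>

lemma prod_span_DERIV:
  assumes "prod_span m f"
  shows "\<exists>f'. \<forall>i<m. prod_span m (f' i) \<and>
    (\<forall>x. ((\<lambda>t. f (x(i := t))) has_real_derivative f' i x) (at (x i)))"
  using assms
proof induction
  case (1 f g)
  show ?case
  proof (intro exI allI impI conjI)
    fix i x assume "i < m"
    then show "prod_span m (\<lambda>x. partial i f x * g x + partial i g x * f x)"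
      using 1 by (intro prod_span.intros smooth_partial)
    show "((\<lambda>t. f (x(i := t)) * g (x(i := t))) has_real_derivative
        partial i f x * g x + partial i g x * f x) (at (x i))"
      using DERIV_mult[OF smooth_DERIV'[OF 1(1) \<open>i < m\<close>, of x] smooth_DERIV'[OF 1(2) \<open>i < m\<close>, of x]] by simp
  qed
next
  case (2 f g)
  then obtain f' g' where
    "\<forall>i<m. prod_span m (f' i) \<and> (\<forall>x. ((\<lambda>t. f (x(i := t))) has_real_derivative f' i x) (at (x i)))"
    "\<forall>i<m. prod_span m (g' i) \<and> (\<forall>x. ((\<lambda>t. g (x(i := t))) has_real_derivative g' i x) (at (x i)))"
    by blast
  note fg = this
  show ?case
  proof (intro exI allI impI conjI)
    fix i x assume "i < m"
    with fg show "prod_span m (\<lambda>x. f' i x + g' i x)"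
      by (auto intro: prod_span.intros(2))
    show "((\<lambda>t. f (x(i := t)) + g (x(i := t))) has_real_derivative f' i x + g' i x) (at (x i))"
      by (rule DERIV_add) (use fg \<open>i < m\<close> in auto)
  qed
qed

lemma prod_span_smooth: "prod_span m f \<Longrightarrow> smooth m f"
proof (erule smooth_coinduct)
  fix f :: "(nat \<Rightarrow> real) \<Rightarrow> real" assume f: "prod_span m f"
  show "f x = f (trunc m x)" for x
    using f by induction (auto simp: smooth_trunc)
  show "continuous_on (pts m) f"
    using f by induction (auto intro!: continuous_on_add continuous_on_mult intro: smooth_continuous)
  fix i assume i: "i < m"
  show "(\<lambda>t. f (x(i := t))) differentiable (at (x i))" for x
    using prod_span_DERIV[OF f] i unfolding real_differentiable_def by metis
  obtain f' where f': "prod_span m (f' i)"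
    "\<forall>x. ((\<lambda>t. f (x(i := t))) has_real_derivative f' i x) (at (x i))"
    using prod_span_DERIV[OF f] i by blast
  then have "partial i f = f' i"
    by (intro ext partial_eqI) auto
  with f' show "prod_span m (partial i f)" by simp
qed

lemma smooth_mult: "smooth m f \<Longrightarrow> smooth m g \<Longrightarrow> smooth m (\<lambda>x. f x * g x)"
  by (rule prod_span_smooth) (rule prod_span.intros(1))

lemma smooth_cmult: "smooth m f \<Longrightarrow> smooth m (\<lambda>x. c * f x)"
  by (rule smooth_mult[OF smooth_const])

lemma smooth_diff: "smooth m f \<Longrightarrow> smooth m g \<Longrightarrow> smooth m (\<lambda>x. f x - g x)"
  using smooth_add[of m f "\<lambda>x. (-1) * g x"] smooth_cmult[of m g "-1"] by simp

lemma partial_diff: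
  assumes "smooth m f" "smooth m g" "i < m"
  shows "partial i (\<lambda>x. f x - g x) = (\<lambda>x. partial i f x - partial i g x)"
  by (intro ext partial_eqI derivative_intros smooth_DERIV'[OF assms(1,3)] smooth_DERIV'[OF assms(2,3)])

lemma partial_sum:
  assumes "\<And>a. a \<in> A \<Longrightarrow> smooth m (f a)" "i < m"
  shows "partial i (\<lambda>x. \<Sum>a\<in>A. f a x) = (\<lambda>x. \<Sum>a\<in>A. partial i (f a) x)"
  by (intro ext partial_eqI DERIV_sum smooth_DERIV'[OF assms])

section \<open>Integration along one coordinate\<close>

text \<open>A fixed compact interval makes the operator well behaved on every continuous function;
  it is the integral over the whole line once f vanishes for |x i| >= R.\<close>

definition fint :: "real \<Rightarrow> nat \<Rightarrow> ((nat \<Rightarrow> real) \<Rightarrow> real) \<Rightarrow> (nat \<Rightarrow> real) \<Rightarrow> real" where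
  "fint R i f x = integral {-R..R} (\<lambda>t. f (x(i := t)))"

definition aint :: "real \<Rightarrow> nat \<Rightarrow> ((nat \<Rightarrow> real) \<Rightarrow> real) \<Rightarrow> (nat \<Rightarrow> real) \<Rightarrow> real" where
  "aint R i f x = integral {-R..x i} (\<lambda>t. f (x(i := t)))"

section \<open>Continuity and differentiation of parameter integrals\<close>

lemma continuous_on_upd:
  fixes g :: "'a::topological_space \<Rightarrow> nat \<Rightarrow> real"
  assumes "continuous_on S g" "continuous_on S h"
  shows "continuous_on S (\<lambda>p. (g p)(i := h p))"
proof (rule continuous_on_coordinatewise_then_product)
  fix j
  have "continuous_on S (\<lambda>p. g p j)"
    using assms(1) by (rule continuous_on_product_then_coordinatewise)
  then show "continuous_on S (\<lambda>p. ((g p)(i := h p)) j)"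
    using assms(2) by (cases "j = i") auto
qed

lemmas continuous_on_upd_intros = continuous_on_upd continuous_on_add continuous_on_mult
  continuous_on_fst continuous_on_snd continuous_on_id continuous_on_const

lemma continuous_on_slice:
  fixes f :: "(nat \<Rightarrow> real) \<Rightarrow> real"
  assumes "continuous_on UNIV f"
  shows "continuous_on S (\<lambda>t. f (x(i := t)))"
  by (rule continuous_on_compose2[OF assms _ subset_UNIV]) (intro continuous_on_upd_intros)

lemma integrable_slice:
  fixes f :: "(nat \<Rightarrow> real) \<Rightarrow> real"
  assumes "continuous_on UNIV f"
  shows "(\<lambda>t. f (x(i := t))) integrable_on {a..b}"
  using continuous_on_slice[OF assms] by (rule integrable_continuous_real)

lemma continuous_on_fint:
  assumes "continuous_on UNIV f"
  shows "continuous_on S (fint R i f)"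
proof -
  have "continuous_on UNIV (\<lambda>x. integral (cbox (-R) R) (\<lambda>t. f (x(i := t))))"
    by (rule integral_continuous_on_param)
      (unfold split_beta', intro continuous_on_compose2[OF assms _ subset_UNIV] continuous_on_upd_intros)
  then show ?thesis
    unfolding fint_def[abs_def] box_real by (rule continuous_on_subset) simp
qed

text \<open>Constant limits of integration turn continuity of \<open>aint\<close> into continuity of a parameter
  integral.\<close>

lemma integral_unit_rescale:
  fixes g :: "real \<Rightarrow> real"
  assumes g: "continuous_on UNIV g" and "a \<le> b"
  shows "integral {a..b} g = (b - a) * integral {0..1} (\<lambda>s. g (a + s * (b - a)))"
proof -
  define F where "F u = integral {a..u} g" for u
  have F: "(F has_real_derivative g u) (at u within {a..b})" if "u \<in> {a..b}" for u
    unfolding F_def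
    by (rule integral_has_real_derivative[OF continuous_on_subset[OF g] that]) simp
  have "((\<lambda>s. F (a + s * (b - a))) has_real_derivative g (a + s * (b - a)) * (b - a)) (at s within {0..1})"
    if "s \<in> {0..1}" for s
  proof -
    have le: "s * (b - a) \<le> b - a" "0 \<le> s * (b - a)" if "s \<in> {0..1}" for s
      using that \<open>a \<le> b\<close> mult_right_mono[of s 1 "b - a"] by auto
    have "(\<lambda>s. a + s * (b - a)) ` {0..1} \<subseteq> {a..b}"
      using le by fastforce
    moreover have "a + s * (b - a) \<in> {a..b}" using le[OF that] by auto
    ultimately have "(F has_real_derivative g (a + s * (b - a)))
        (at (a + s * (b - a)) within (\<lambda>s. a + s * (b - a)) ` {0..1})"
      using F DERIV_subset by blast
    moreover have "((\<lambda>s. a + s * (b - a)) has_real_derivative (b - a)) (at s within {0..1})"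
      by (auto intro!: derivative_eq_intros)
    ultimately show ?thesis
      using DERIV_image_chain[of F _ "\<lambda>s. a + s * (b - a)" s "{0..1}" "b - a"] by (simp add: o_def)
  qed
  then have "((\<lambda>s. g (a + s * (b - a)) * (b - a)) has_integral
      (F (a + 1 * (b - a)) - F (a + 0 * (b - a)))) {0..1}"
    by (intro fundamental_theorem_of_calculus) (auto simp: has_real_derivative_iff_has_vector_derivative)
  from integral_unique[OF this] show ?thesis
    by (simp add: F_def mult.commute)
qed

lemma aint_rescale:
  assumes f: "continuous_on UNIV f" and f0: "\<And>x. x i \<le> -R \<Longrightarrow> f x = 0"
  shows "aint R i f x = (x i + R) * integral {0..1} (\<lambda>s. f (x(i := -R + s * (x i + R))))"
proof (cases "-R \<le> x i")
  case True
  then show ?thesis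
    using integral_unit_rescale[OF continuous_on_slice[OF f] True, of x i] by (simp add: aint_def)
next
  case False
  \<comment> \<open>Left of -R the interval of \<open>aint\<close> is empty, and on the other side
    all sample points lie left of -R, where f vanishes.\<close>
  have "f (x(i := -R + s * (x i + R))) = 0" if "s \<in> {0..1}" for s
    using that False by (intro f0) (auto intro: mult_nonneg_nonpos)
  then have "integral {0..1} (\<lambda>s. f (x(i := -R + s * (x i + R)))) = integral {0..1} (\<lambda>s::real. 0::real)"
    by (intro integral_cong)
  moreover have "aint R i f x = 0"
    using False by (simp add: aint_def)
  ultimately show ?thesis by simp
qed

lemma continuous_on_aint:
  assumes f: "continuous_on UNIV f" and f0: "\<And>x. x i \<le> -R \<Longrightarrow> f x = 0"
  shows "continuous_on S (aint R i f)"
proof -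
  have c: "continuous_on A (\<lambda>x::nat \<Rightarrow> real. x i)" for A
    by (rule continuous_on_subset[OF continuous_on_product_coordinates]) simp
  have c': "continuous_on A (\<lambda>z::(nat \<Rightarrow> real) \<times> real. fst z i)" for A
    by (rule continuous_on_compose2[OF c[of UNIV] _ subset_UNIV]) (intro continuous_on_fst continuous_on_id)
  have "continuous_on UNIV (\<lambda>x. integral (cbox 0 1) (\<lambda>s. f (x(i := -R + s * (x i + R)))))"
    by (rule integral_continuous_on_param)
      (unfold split_beta', intro continuous_on_compose2[OF f _ subset_UNIV] continuous_on_upd_intros c')
  then have "continuous_on UNIV (\<lambda>x. (x i + R) * integral {0..1} (\<lambda>s. f (x(i := -R + s * (x i + R)))))"
    unfolding box_real by (intro continuous_intros c)
  then show ?thesis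
    using aint_rescale[OF f f0] by (simp add: continuous_on_subset[OF _ subset_UNIV] cong: continuous_on_cong)
qed

text \<open>The fundamental theorem yields a derivative within an interval only, and {a..s}
  degenerates for s <= a. As g vanishes left of a, the base point can be moved left without changing
  the integral.\<close>

lemma antiderivative_DERIV:
  fixes g :: "real \<Rightarrow> real"
  assumes g: "continuous_on UNIV g" and g0: "\<And>t. t \<le> a \<Longrightarrow> g t = 0"
  shows "((\<lambda>s. integral {a..s} g) has_real_derivative g s) (at s)"
proof -
  \<comment> \<open>Strictly below s, so that s is interior to {L..s+1}, and below a, where g is
    0.\<close>
  define L where "L = min a s - 1"
  have int: "g integrable_on {u..v}" for u v
    using g by (intro integrable_continuous_real) (auto intro: continuous_on_subset)
  have eq: "integral {L..s'} g = integral {a..s'} g" if "L < s'" for s'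
  proof (cases "a \<le> s'")
    case True
    have "integral {L..a} g = integral {L..a} (\<lambda>_. 0)"
      by (intro integral_cong) (auto simp: g0)
    then show ?thesis
      using Henstock_Kurzweil_Integration.integral_combine[of L a s' g] int True by (simp add: L_def)
  next
    case False
    have "integral {L..s'} g = integral {L..s'} (\<lambda>_. 0)"
      using False by (intro integral_cong) (auto simp: g0)
    then show ?thesis using False by simp
  qed
  have "((\<lambda>s. integral {L..s} g) has_real_derivative g s) (at s within {L..s+1})"
    using g by (intro integral_has_real_derivative) (auto simp: L_def intro: continuous_on_subset)
  then have "((\<lambda>s. integral {L..s} g) has_real_derivative g s) (at s)"
    by (subst (asm) at_within_interior) (auto simp: L_def)
  moreover have "s \<in> {L<..}" by (simp add: L_def)
  ultimately show ?thesis
    using has_field_derivative_transform_within_open[of _ _ s "{L<..}" "\<lambda>s. integral {a..s} g"] eq by simp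
qed

lemma aint_DERIV_self:
  assumes f: "continuous_on UNIV f" and f0: "\<And>x. x i \<le> -R \<Longrightarrow> f x = 0"
  shows "((\<lambda>t. aint R i f (x(i := t))) has_real_derivative f x) (at (x i))"
  using antiderivative_DERIV[OF continuous_on_slice[OF f, of _ x i], of "-R" "x i"] f0
  by (simp add: aint_def)

text \<open>Leibniz rule, shared by \<open>fint\<close> and \<open>aint\<close>: for j different
  from i the limits of integration do not move with x_j.\<close>

lemma slice_integral_DERIV:
  assumes f: "smooth m f" and j: "j < m" "j \<noteq> i"
  shows "((\<lambda>s. integral {a..b} (\<lambda>t. f (x(j := s, i := t)))) has_real_derivative
     integral {a..b} (\<lambda>t. partial j f (x(i := t)))) (at (x j))"
proof -
  have c: "continuous_on UNIV f" "continuous_on UNIV (partial j f)"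
    using f j smooth_continuous smooth_partial by blast+
  have "((\<lambda>s. integral (cbox a b) (\<lambda>t. f (x(i := t, j := s)))) has_real_derivative
     integral (cbox a b) (\<lambda>t. partial j f (x(i := t, j := x j)))) (at (x j) within UNIV)"
  proof (rule leibniz_rule_field_derivative)
    fix s t :: real
    show "((\<lambda>s. f (x(i := t, j := s))) has_real_derivative partial j f (x(i := t, j := s))) (at s within UNIV)"
      by (rule smooth_DERIV[OF f j(1)])
    show "(\<lambda>t. f (x(i := t, j := s))) integrable_on cbox a b"
      using integrable_slice[OF c(1), of "x(j := s)" i a b] j by (simp add: fun_upd_twist)
  next
    show "continuous_on (UNIV \<times> cbox a b) (\<lambda>(s, t). partial j f (x(i := t, j := s)))"
      by (unfold split_beta', intro continuous_on_compose2[OF c(2) _ subset_UNIV] continuous_on_upd_intros)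
  qed auto
  moreover have "x(i := t, j := x j) = x(i := t)" for t
    using j by auto
  ultimately show ?thesis
    using j by (simp add: fun_upd_twist)
qed

lemma fint_upd_self [simp]: "fint R i f (x(i := t)) = fint R i f x"
  by (simp add: fint_def)

lemma fint_DERIV:
  assumes f: "smooth m f" and j: "j < m" "j \<noteq> i"
  shows "((\<lambda>t. fint R i f (x(j := t))) has_real_derivative fint R i (partial j f) x) (at (x j))"
  unfolding fint_def by (rule slice_integral_DERIV[OF assms])

lemma aint_DERIV:
  assumes f: "smooth m f" and j: "j < m" "j \<noteq> i"
  shows "((\<lambda>t. aint R i f (x(j := t))) has_real_derivative aint R i (partial j f) x) (at (x j))"
  using slice_integral_DERIV[OF assms] j by (simp add: aint_def)

lemma partial_fint: "smooth m f \<Longrightarrow> j < m \<Longrightarrow> j \<noteq> i \<Longrightarrow> partial j (fint R i f) = fint R i (partial j f)"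
  by (intro ext partial_eqI fint_DERIV)

lemma partial_fint_self: "partial i (fint R i f) = (\<lambda>x. 0)"
  by (intro ext partial_eqI) simp

lemma partial_aint: "smooth m f \<Longrightarrow> j < m \<Longrightarrow> j \<noteq> i \<Longrightarrow> partial j (aint R i f) = aint R i (partial j f)"
  by (intro ext partial_eqI aint_DERIV)

lemma partial_aint_self:
  assumes "continuous_on UNIV f" "\<And>x. x i \<le> -R \<Longrightarrow> f x = 0"
  shows "partial i (aint R i f) = f"
  by (intro ext partial_eqI aint_DERIV_self assms)

text \<open>The coinduction class contains 0 because the derivative in the integrated coordinate is
  0.\<close>

lemma smooth_fint:
  assumes "smooth m f" "i < m"
  shows "smooth m (fint R i f)"
proof -
  let ?P = "\<lambda>h. (\<exists>g. h = fint R i g \<and> smooth m g) \<or> h = (\<lambda>x. 0)"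
  have "?P (fint R i f)"
    using assms by blast
  then show ?thesis
  proof (rule smooth_coinduct[where P = ?P], goal_cases)
    case (1 f x)
    then show ?case using assms(2)
      by (auto simp: fint_def trunc_upd[symmetric] smooth_trunc)
  next
    case (2 f) then show ?case using smooth_continuous[of m] by (auto intro!: continuous_on_fint)
  next
    case (3 f j x)
    show ?case
    proof (cases "j = i")
      case True
      then show ?thesis
        using 3 unfolding real_differentiable_def by (auto intro!: exI[of _ 0])
    next
      case False
      then show ?thesis
        using 3 fint_DERIV[of m _ j i R x] unfolding real_differentiable_def by (auto intro: DERIV_const)
    qed
  next
    case (4 f j)
    then show ?case
      using partial_fint[of m _ j i R] smooth_partial[of m _ j]
      by (cases "j = i") (auto simp: partial_fint_self partial_const)
  qed
qed

lemma partial_vanishes: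
  assumes "\<And>x. x i \<le> -R \<Longrightarrow> f x = 0" "j \<noteq> i" "x i \<le> -R"
  shows "partial j f x = (0::real)"
  using assms by (intro partial_eqI) simp

text \<open>The derivative in x_i gives back the integrand, so the class must contain all smooth
  functions. The derivatives in the other directions act on the integrand and keep it zero left of
  -R.\<close>

lemma smooth_aint:
  assumes "smooth m f" "i < m" "\<And>x. x i \<le> -R \<Longrightarrow> f x = 0"
  shows "smooth m (aint R i f)"
proof -
  let ?P = "\<lambda>h. (\<exists>g. h = aint R i g \<and> smooth m g \<and> (\<forall>x. x i \<le> -R \<longrightarrow> g x = 0)) \<or> smooth m h"
  have "?P (aint R i f)"
    using assms by blast
  then show ?thesis
  proof (rule smooth_coinduct[where P = ?P], goal_cases)
    case (1 f x)
    then show ?case using assms(2)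
      by (auto simp: aint_def trunc_upd[symmetric] smooth_trunc) (simp add: trunc_def)
  next
    case (2 f) then show ?case using smooth_continuous[of m] by (auto intro!: continuous_on_aint)
  next
    case (3 f j x)
    consider "smooth m f"
      | g where "f = aint R i g" "smooth m g" "\<forall>x. x i \<le> -R \<longrightarrow> g x = 0" using 3 by blast
    then show ?case
    proof cases
      case 1
      then show ?thesis using 3 smooth_differentiable by blast
    next
      case 2
      then show ?thesis
        using aint_DERIV_self[of g i R x] aint_DERIV[of m g j i R x] smooth_continuous[of m g] 3
        unfolding real_differentiable_def by (cases "j = i") auto
    qed
  next
    case (4 f j)
    consider "smooth m f"
      | g where "f = aint R i g" "smooth m g" "\<forall>x. x i \<le> -R \<longrightarrow> g x = 0" using 4 by blast
    then show ?case
    proof cases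
      case 1
      then show ?thesis using 4 smooth_partial by blast
    next
      case 2
      show ?thesis
      proof (cases "j = i")
        case True
        then show ?thesis using 2 partial_aint_self[of g i R] smooth_continuous by auto
      next
        case False
        then have "\<forall>x. x i \<le> -R \<longrightarrow> partial j g x = 0"
          using 2 partial_vanishes[of i R g j] by simp
        then show ?thesis
          using 2 partial_aint[of m g j i R] False 4 smooth_partial[of m g j] by auto
      qed
    qed
  qed
qed

lemma aint_partial_self:
  assumes "smooth m f" "i < m" "\<And>x. x i \<le> -R \<Longrightarrow> f x = 0"
  shows "aint R i (partial i f) = f"
proof
  fix x
  show "aint R i (partial i f) x = f x"
  proof (cases "-R \<le> x i")
    case True
    have "((\<lambda>t. f (x(i := t))) has_vector_derivative partial i f (x(i := t))) (at t within {-R..x i})" for t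
      using smooth_DERIV[OF assms(1,2), of x t]
      by (simp add: has_real_derivative_iff_has_vector_derivative has_vector_derivative_at_within)
    from fundamental_theorem_of_calculus[OF True this]
    have "((\<lambda>t. partial i f (x(i := t))) has_integral (f (x(i := x i)) - f (x(i := -R)))) {-R..x i}" .
    then show ?thesis by (simp add: aint_def assms(3) integral_unique)
  qed (simp add: aint_def assms(3))
qed

lemma fint_eq_aint: "fint R i f x = aint R i f (x(i := R))"
  by (simp add: fint_def aint_def)

text \<open>Beyond the support the antiderivative has reached its final value. This is what makes
  \<open>Q\<close> vanish to the right of R.\<close>

lemma aint_ge:
  assumes "continuous_on UNIV f" "\<And>x. R \<le> x i \<Longrightarrow> f x = 0" "R \<le> x i" "0 \<le> R"
  shows "aint R i f x = fint R i f x"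
proof -
  have "integral {R..x i} (\<lambda>t. f (x(i := t))) = integral {R..x i} (\<lambda>_. 0)"
    by (intro integral_cong) (auto simp: assms(2))
  moreover have "integral {-R..R} (\<lambda>t. f (x(i := t))) + integral {R..x i} (\<lambda>t. f (x(i := t))) =
      integral {-R..x i} (\<lambda>t. f (x(i := t)))"
    using assms integrable_slice[OF assms(1)]
    by (intro Henstock_Kurzweil_Integration.integral_combine) auto
  ultimately show ?thesis
    by (simp add: fint_def aint_def)
qed

lemma fint_commute:
  assumes "continuous_on UNIV f"
  shows "fint R i (fint R j f) = fint R j (fint R i f)"
proof (cases "i = j")
  case False
  have "integral (cbox (-R) R) (\<lambda>t. integral (cbox (-R) R) (\<lambda>s. f (x(i := t, j := s)))) =
        integral (cbox (-R) R) (\<lambda>s. integral (cbox (-R) R) (\<lambda>t. f (x(i := t, j := s))))" for x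
    by (rule integral_swap_continuous)
      (unfold split_beta', intro continuous_on_compose2[OF assms _ subset_UNIV] continuous_on_upd_intros)
  then show ?thesis
    using False by (intro ext) (simp add: fint_def fun_upd_twist)
qed simp

lemma fint_lincomb:
  assumes "\<And>a. a \<in> A \<Longrightarrow> continuous_on UNIV (f a)"
  shows "fint R i (\<lambda>x. \<Sum>a\<in>A. c a * f a x) = (\<lambda>x. \<Sum>a\<in>A. c a * fint R i (f a) x)"
proof
  fix x
  have "(\<lambda>t. c a * f a (x(i := t))) integrable_on {-R..R}" if "a \<in> A" for a
    using integrable_slice[OF assms[OF that]] by (intro integrable_on_mult_right)
  then show "fint R i (\<lambda>x. \<Sum>a\<in>A. c a * f a x) x = (\<Sum>a\<in>A. c a * fint R i (f a) x)"
    unfolding fint_def by (cases "finite A") (simp_all add: integral_sum)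
qed

lemma aint_lincomb:
  assumes "\<And>a. a \<in> A \<Longrightarrow> continuous_on UNIV (f a)"
  shows "aint R i (\<lambda>x. \<Sum>a\<in>A. c a * f a x) = (\<lambda>x. \<Sum>a\<in>A. c a * aint R i (f a) x)"
proof
  fix x
  have "(\<lambda>t. c a * f a (x(i := t))) integrable_on {-R..x i}" if "a \<in> A" for a
    using integrable_slice[OF assms[OF that]] by (intro integrable_on_mult_right)
  then show "aint R i (\<lambda>x. \<Sum>a\<in>A. c a * f a x) x = (\<Sum>a\<in>A. c a * aint R i (f a) x)"
    unfolding aint_def by (cases "finite A") (simp_all add: integral_sum)
qed

lemma fint_0 [simp]: "fint R i (\<lambda>x. 0) = (\<lambda>x. 0)"
  by (simp add: fint_def[abs_def])

lemma aint_0 [simp]: "aint R i (\<lambda>x. 0) = (\<lambda>x. 0)"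
  by (simp add: aint_def[abs_def])

lemma fint_indep:
  assumes "\<And>x t. f (x(l := t)) = f x"
  shows "fint R i f (x(l := t)) = fint R i f x"
proof (cases "l = i")
  case False
  then have "f (x(l := t, i := s)) = f (x(i := s))" for s
    using assms[of "x(i := s)"] by (simp add: fun_upd_twist)
  then show ?thesis by (simp add: fint_def)
qed simp

lemma fint_mult_indep:
  assumes "\<And>x t. g (x(i := t)) = g x"
  shows "fint R i (\<lambda>x. g x * f x) = (\<lambda>x. g x * fint R i f x)"
  by (simp add: fint_def[abs_def] assms)

lemma fint_vanishes:
  assumes "\<And>x. R \<le> \<bar>x l\<bar> \<Longrightarrow> f x = 0" "l \<noteq> i" "R \<le> \<bar>x l\<bar>"
  shows "fint R i f x = 0"
  using assms by (simp add: fint_def)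

lemma fint_partial_self:
  assumes "smooth m f" "i < m" "\<And>x. R \<le> \<bar>x i\<bar> \<Longrightarrow> f x = 0"
  shows "fint R i (partial i f) = (\<lambda>x. 0)"
proof
  fix x
  have "aint R i (partial i f) = f"
    using assms by (intro aint_partial_self) auto
  then show "fint R i (partial i f) x = 0"
    using assms(3) by (simp add: fint_eq_aint)
qed

section \<open>Iterated integrals\<close>

text \<open>The head of the list is integrated first, so dropping it matches passing from a form to
  its projection in that coordinate.\<close>

definition iint :: "real \<Rightarrow> nat list \<Rightarrow> ((nat \<Rightarrow> real) \<Rightarrow> real) \<Rightarrow> (nat \<Rightarrow> real) \<Rightarrow> real" where
  "iint R = fold (fint R)"

lemma iint_simps [simp]:
  "iint R [] f = f" "iint R (i # js) f = iint R js (fint R i f)"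
  by (simp_all add: iint_def)

lemma smooth_iint: "set js \<subseteq> {..<m} \<Longrightarrow> smooth m f \<Longrightarrow> smooth m (iint R js f)"
  by (induction js arbitrary: f) (auto intro: smooth_fint)

lemma iint_fint:
  "set js \<subseteq> {..<m} \<Longrightarrow> smooth m f \<Longrightarrow> i < m \<Longrightarrow> iint R js (fint R i f) = fint R i (iint R js f)"
proof (induction js arbitrary: f)
  case (Cons a js)
  then show ?case
    using fint_commute[OF smooth_continuous, of m f R a i] smooth_fint[of m f a] by simp
qed simp

text \<open>By Fubini the omitted coordinate may be integrated last instead of in its place in the
  list.\<close>

lemma fint_iint_removeAll:
  "distinct js \<Longrightarrow> set js \<subseteq> {..<m} \<Longrightarrow> smooth m f \<Longrightarrow> i \<in> set js \<Longrightarrow>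
    fint R i (iint R (removeAll i js) f) = iint R js f"
proof (induction js arbitrary: f)
  case (Cons a js)
  then show ?case
    using iint_fint[of js m f i R] smooth_fint[of m f a] by (cases "a = i") auto
qed simp

lemma iint_0 [simp]: "iint R js (\<lambda>x. 0) = (\<lambda>x. 0)"
  by (induction js) auto

text \<open>The disjunction is the induction invariant: once l itself has been integrated, the
  second alternative takes over and persists.\<close>

lemma iint_indep:
  "l \<in> set js \<or> (\<forall>x t. f (x(l := t)) = f x) \<Longrightarrow> iint R js f (x(l := t)) = iint R js f x"
proof (induction js arbitrary: f)
  case (Cons a js)
  then have "l \<in> set js \<or> (\<forall>x t. fint R a f (x(l := t)) = fint R a f x)"
    using fint_indep[of f l R a] fint_upd_self[of R a f] by (metis set_ConsD)
  then show ?case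
    unfolding iint_simps by (rule Cons.IH)
qed simp

lemma iint_mult_indep:
  "(\<And>i x t. i \<in> set js \<Longrightarrow> g (x(i := t)) = g x) \<Longrightarrow>
    iint R js (\<lambda>x. g x * f x) = (\<lambda>x. g x * iint R js f x)"
  by (induction js arbitrary: f) (auto simp: fint_mult_indep)

lemma iint_vanishes:
  "l \<notin> set js \<Longrightarrow> (\<And>x. R \<le> \<bar>x l\<bar> \<Longrightarrow> f x = 0) \<Longrightarrow> R \<le> \<bar>x l\<bar> \<Longrightarrow> iint R js f x = 0"
proof (induction js arbitrary: f)
  case (Cons a js)
  have "iint R js (fint R a f) x = 0"
    by (rule Cons.IH) (use Cons.prems fint_vanishes[of R l f a] in auto)
  then show ?case by simp
qed auto

lemma iint_lincomb:
  assumes "set js \<subseteq> {..<m}" "\<And>a. a \<in> A \<Longrightarrow> smooth m (f a)"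
  shows "iint R js (\<lambda>x. \<Sum>a\<in>A. c a * f a x) = (\<lambda>x. \<Sum>a\<in>A. c a * iint R js (f a) x)"
  using assms
proof (induction js arbitrary: f)
  case (Cons i js)
  then have "fint R i (\<lambda>x. \<Sum>a\<in>A. c a * f a x) = (\<lambda>x. \<Sum>a\<in>A. c a * fint R i (f a) x)"
    by (intro fint_lincomb) (auto intro: smooth_continuous)
  then show ?case
    using Cons by (simp add: smooth_fint)
qed simp

text \<open>Stokes for one derivative: integrations in other coordinates commute with
  \<open>partial i\<close> and preserve the vanishing for |x i| >= R, until integration in x_i
  leaves only zero boundary values.\<close>

lemma iint_partial:
  assumes "set js \<subseteq> {..<m}" "i \<in> set js" "smooth m f" "\<And>x. R \<le> \<bar>x i\<bar> \<Longrightarrow> f x = 0"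
  shows "iint R js (partial i f) = (\<lambda>x. 0)"
  using assms
proof (induction js arbitrary: f)
  case (Cons a js)
  show ?case
  proof (cases "a = i")
    case True
    then show ?thesis
      using Cons.prems by (simp add: fint_partial_self)
  next
    case False
    have "iint R js (partial i (fint R a f)) = (\<lambda>x. 0)"
      by (rule Cons.IH) (use Cons.prems False fint_vanishes[of R i f a] in \<open>auto intro: smooth_fint\<close>)
    then show ?thesis
      using Cons.prems False by (auto simp: partial_fint)
  qed
qed simp

text \<open>Consecutive truncations of x differ in one coordinate, and the first is the origin.
  Applied to full iterated integrals, which are therefore constant functions.\<close>

lemma eq_at_zero:
  assumes "\<And>x. f (trunc m x) = f x" "\<And>i x t. i < m \<Longrightarrow> f (x(i := t)) = f x"
  shows "f x = f (\<lambda>_. 0)"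
proof -
  have "f (trunc p x) = f (\<lambda>_. 0)" if "p \<le> m" for p
    using that
  proof (induction p)
    case 0
    then show ?case by (simp add: trunc_def)
  next
    case (Suc p)
    have "trunc (Suc p) x = (trunc p x)(p := x p)"
      by (auto simp: trunc_def)
    moreover have "f ((trunc p x)(p := x p)) = f (trunc p x)"
      using Suc.prems by (intro assms(2)) simp
    ultimately show ?case using Suc.IH Suc.prems by (metis Suc_leD)
  qed
  then show ?thesis using assms(1) by (metis order_refl)
qed

section \<open>Comparison with the Lebesgue integral on R^m\<close>

lemma bounded_on_box:
  fixes f :: "(nat \<Rightarrow> real) \<Rightarrow> real"
  assumes "continuous_on UNIV f"
  shows "\<exists>C. \<forall>x. (\<forall>i<p. \<bar>x i\<bar> \<le> R) \<longrightarrow> \<bar>f (trunc p x)\<bar> \<le> C"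
proof -
  \<comment> \<open>The factors {0} at indices from p on make this a compact subset of the infinite
    product (Tychonoff) that contains the truncated points.\<close>
  let ?K = "PiE UNIV (\<lambda>i. if i < p then {-R..R} else {0::real})"
  have "compactin (product_topology (\<lambda>i. euclidean) UNIV) ?K"
    by (subst compactin_PiE) (auto simp: compactin_euclidean_iff)
  then have "compact ?K"
    by (simp add: euclidean_product_topology compactin_euclidean_iff)
  then have "bounded (f ` ?K)"
    using assms by (intro compact_imp_bounded compact_continuous_image) (auto intro: continuous_on_subset)
  then obtain C where C: "\<And>x. x \<in> ?K \<Longrightarrow> \<bar>f x\<bar> \<le> C"
    unfolding bounded_iff by auto
  show ?thesis
    by (intro exI[of _ C] allI impI C) (auto simp: trunc_def abs_le_iff)
qed

lemma borel_measurable_trunc: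
  fixes f :: "(nat \<Rightarrow> real) \<Rightarrow> real"
  assumes "continuous_on UNIV f"
  shows "(\<lambda>y. f (trunc p y)) \<in> borel_measurable (PiM {..<p} (\<lambda>_. lborel))"
proof -
  have "trunc p \<in> borel_measurable (PiM {..<p} (\<lambda>_. lborel))"
  proof (rule measurable_coordinatewise_then_product)
    show "(\<lambda>y. trunc p y i) \<in> borel_measurable (PiM {..<p} (\<lambda>_. lborel))" for i
      by (cases "i < p") (simp_all add: trunc_def)
  qed
  then show ?thesis
    using borel_measurable_continuous_onI[OF assms] by (rule measurable_compose)
qed

lemma integrable_trunc:
  fixes f :: "(nat \<Rightarrow> real) \<Rightarrow> real"
  assumes "continuous_on UNIV f" and 0: "\<And>x i. i < p \<Longrightarrow> R \<le> \<bar>x i\<bar> \<Longrightarrow> f x = 0"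
  shows "integrable (PiM {..<p} (\<lambda>_. lborel)) (\<lambda>y. f (trunc p y))"
proof -
  interpret product_sigma_finite "\<lambda>_::nat. lborel :: real measure" ..
  obtain C where C: "\<And>x. (\<forall>i<p. \<bar>x i\<bar> \<le> R) \<Longrightarrow> \<bar>f (trunc p x)\<bar> \<le> C"
    using bounded_on_box[OF assms(1)] by blast
  show ?thesis
  proof (rule integrableI_bounded_set[where A = "PiE {..<p} (\<lambda>_. {-R..R})" and B = C])
    show "PiE {..<p} (\<lambda>_. {-R..R}) \<in> sets (PiM {..<p} (\<lambda>_. lborel))"
      by (intro sets_PiM_I_finite) auto
    have "emeasure (PiM {..<p} (\<lambda>_. lborel)) (PiE {..<p} (\<lambda>_. {-R..R})) = (\<Prod>i<p. emeasure lborel {-R..R})"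
      by (intro emeasure_PiM) auto
    also have "\<dots> < \<infinity>"
      by (auto simp: emeasure_lborel_Icc_eq ennreal_power[symmetric] power_less_top_ennreal split: if_splits)
    finally show "emeasure (PiM {..<p} (\<lambda>_. lborel)) (PiE {..<p} (\<lambda>_. {-R..R})) < \<infinity>" .
    show "AE x in PiM {..<p} (\<lambda>_. lborel). x \<in> PiE {..<p} (\<lambda>_. {-R..R}) \<longrightarrow> norm (f (trunc p x)) \<le> C"
    proof (intro AE_I2 impI)
      fix x assume "x \<in> PiE {..<p} (\<lambda>_. {-R..R})"
      then have "\<forall>i<p. \<bar>x i\<bar> \<le> R"
        by (simp add: PiE_iff abs_le_iff minus_le_iff)
      then show "norm (f (trunc p x)) \<le> C"
        using C by simp
    qed
    show "AE x in PiM {..<p} (\<lambda>_. lborel). x \<notin> PiE {..<p} (\<lambda>_. {-R..R}) \<longrightarrow> f (trunc p x) = 0"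
    proof (intro AE_I2 impI)
      fix x :: "nat \<Rightarrow> real"
      assume "x \<in> space (PiM {..<p} (\<lambda>_. lborel))" "x \<notin> PiE {..<p} (\<lambda>_. {-R..R})"
      then obtain i where "i < p" "x i \<notin> {-R..R}"
        by (auto simp: space_PiM PiE_iff)
      then show "f (trunc p x) = 0"
        by (intro 0[of i]) (auto simp: trunc_def)
    qed
  qed (rule borel_measurable_trunc[OF assms(1)])
qed

lemma fint_eq_lborel:
  assumes f: "continuous_on UNIV f" and 0: "\<And>x. R \<le> \<bar>x i\<bar> \<Longrightarrow> f x = 0"
  shows "(\<integral>t. f (x(i := t)) \<partial>lborel) = fint R i f x"
proof -
  have "(\<integral>t. f (x(i := t)) \<partial>lborel) = (\<integral>t. indicator {-R..R} t *\<^sub>R f (x(i := t)) \<partial>lborel)"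
    by (intro Bochner_Integration.integral_cong) (auto simp: indicator_def intro!: 0)
  also have "\<dots> = (LINT t:{-R..R}|lborel. f (x(i := t)))"
    by (simp add: set_lebesgue_integral_def)
  also have "\<dots> = fint R i f x"
    using continuous_on_slice[OF f] unfolding fint_def
    by (intro set_borel_integral_eq_integral borel_integrable_atLeastAtMost')
  finally show ?thesis .
qed

text \<open>The product measure is split at its last coordinate, which becomes the inner integral;
  hence the descending list. For p = 0 the measure space is a single point and both sides evaluate f
  at the origin.\<close>

lemma integral_Rm_eq_iint:
  assumes "continuous_on UNIV f" "\<And>x i. i < p \<Longrightarrow> R \<le> \<bar>x i\<bar> \<Longrightarrow> f x = 0"
  shows "integral_Rm p f = iint R (rev [0..<p]) f (\<lambda>_. 0)"
  using assms
proof (induction p arbitrary: f)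
  case 0
  interpret product_sigma_finite "\<lambda>_::nat. lborel :: real measure" ..
  show ?case
    by (simp add: integral_Rm_def trunc_def PiM_empty lebesgue_integral_count_space_finite)
next
  case (Suc p)
  interpret product_sigma_finite "\<lambda>_::nat. lborel :: real measure" ..
  have tr: "trunc (Suc p) (x(p := t)) = (trunc p x)(p := t)" for x t
    by (auto simp: trunc_def)
  have "integral_Rm (Suc p) f =
      (\<integral>x. (\<integral>t. f (trunc (Suc p) (x(p := t))) \<partial>lborel) \<partial>PiM {..<p} (\<lambda>_. lborel))"
    unfolding integral_Rm_def lessThan_Suc
    by (rule product_integral_insert)
      (simp_all add: integrable_trunc[of f "Suc p", OF Suc.prems, unfolded lessThan_Suc])
  also have "\<dots> = integral_Rm p (fint R p f)"
    unfolding integral_Rm_def tr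
    by (intro Bochner_Integration.integral_cong fint_eq_lborel Suc.prems) auto
  also have "\<dots> = iint R (rev [0..<p]) (fint R p f) (\<lambda>_. 0)"
  proof (rule Suc.IH)
    show "continuous_on UNIV (fint R p f)"
      by (rule continuous_on_fint[OF Suc.prems(1)])
    show "fint R p f x = 0" if "i < p" "R \<le> \<bar>x i\<bar>" for x i
      by (rule fint_vanishes[of R i]) (use that Suc.prems(2)[of i] in auto)
  qed
  finally show ?case by simp
qed

section \<open>Compactly supported forms on \<open>R^m\<close>\<close>

text \<open>An explicit radius lets many coefficients share one interval. Vanishing already at |x i|
  = R kills the boundary terms of the fundamental theorem of calculus.\<close>

definition csmooth :: "nat \<Rightarrow> real \<Rightarrow> ((nat \<Rightarrow> real) \<Rightarrow> real) \<Rightarrow> bool" where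
  "csmooth m R f \<longleftrightarrow> smooth m f \<and> (\<forall>x. \<forall>i<m. R \<le> \<bar>x i\<bar> \<longrightarrow> f x = 0)"

lemma csmoothD:
  assumes "csmooth m R f"
  shows "smooth m f" "i < m \<Longrightarrow> R \<le> \<bar>x i\<bar> \<Longrightarrow> f x = 0"
  using assms by (auto simp: csmooth_def)

lemma csmooth_0: "csmooth m R (\<lambda>x. 0)"
  by (simp add: csmooth_def smooth_const)

lemma csmooth_add: "csmooth m R f \<Longrightarrow> csmooth m R g \<Longrightarrow> csmooth m R (\<lambda>x. f x + g x)"
  by (simp add: csmooth_def smooth_add)

lemma csmooth_cmult: "csmooth m R f \<Longrightarrow> csmooth m R (\<lambda>x. c * f x)"
  by (simp add: csmooth_def smooth_cmult)

lemma csmooth_mono: "csmooth m R f \<Longrightarrow> R \<le> R' \<Longrightarrow> csmooth m R' f"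
  by (auto simp: csmooth_def)

text \<open>The Koszul sign for moving the generator of index i past the smaller indices of J,
  whether or not i lies in J.\<close>

definition ksgn :: "nat set \<Rightarrow> nat \<Rightarrow> real" where
  "ksgn J i = (-1) ^ card {j\<in>J. j < i}"

lemma ksgn_square [simp]: "ksgn J i * ksgn J i = 1"
  by (simp add: ksgn_def flip: power_add)

lemma ksgn_square' [simp]: "ksgn J i * (ksgn J i * c) = c"
  by (simp flip: mult.assoc)

lemma ksgn_insert:
  assumes "finite J" "a \<notin> J"
  shows "ksgn (insert a J) i = (if a < i then - ksgn J i else ksgn J i)"
proof -
  have "{j \<in> insert a J. j < i} = (if a < i then insert a {j\<in>J. j < i} else {j\<in>J. j < i})"
    by auto
  then show ?thesis
    using assms by (simp add: ksgn_def)
qed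

lemma ksgn_remove:
  assumes "finite J" "a \<in> J"
  shows "ksgn (J - {a}) i = (if a < i then - ksgn J i else ksgn J i)"
  using ksgn_insert[of "J - {a}" a i] assms by (auto simp: insert_absorb)

text \<open>Coefficient families of forms of degree \<open>k - s\<close>; the shift \<open>s = 1\<close> expresses degree
  \<open>k - 1\<close> without truncated subtraction, forcing the form to vanish when \<open>k = 0\<close>.\<close>

definition rform :: "nat \<Rightarrow> real \<Rightarrow> nat \<Rightarrow> nat \<Rightarrow> (nat set \<Rightarrow> (nat \<Rightarrow> real) \<Rightarrow> real) \<Rightarrow> bool" where
  "rform m R s k u \<longleftrightarrow>
    (\<forall>J. csmooth m R (u J) \<and> (u J \<noteq> (\<lambda>x. 0) \<longrightarrow> J \<subseteq> {..<m} \<and> card J + s = k))"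

definition rd :: "nat \<Rightarrow> (nat set \<Rightarrow> (nat \<Rightarrow> real) \<Rightarrow> real) \<Rightarrow> nat set \<Rightarrow> (nat \<Rightarrow> real) \<Rightarrow> real" where
  "rd m u J x = (if J \<subseteq> {..<m} then \<Sum>i\<in>J. ksgn J i * partial i (u (J - {i})) x else 0)"

lemma rformD:
  assumes "rform m R s k u"
  shows "csmooth m R (u J)" "smooth m (u J)" "u J \<noteq> (\<lambda>x. 0) \<Longrightarrow> J \<subseteq> {..<m} \<and> card J + s = k"
  using assms by (auto simp: rform_def csmooth_def)

lemma rform_add:
  assumes "rform m R s k u" "rform m R s k v"
  shows "rform m R s k (\<lambda>J x. u J x + v J x)"
proof -
  have "J \<subseteq> {..<m} \<and> card J + s = k" if "(\<lambda>x. u J x + v J x) \<noteq> (\<lambda>x. 0)" for J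
    using that rformD(3)[OF assms(1), of J] rformD(3)[OF assms(2), of J] by fastforce
  then show ?thesis
    using assms by (simp add: rform_def csmooth_add)
qed

lemma rd_add:
  assumes "rform m R s k u" "rform m R s k v"
  shows "rd m (\<lambda>J x. u J x + v J x) = (\<lambda>J x. rd m u J x + rd m v J x)"
proof (intro ext)
  fix J x
  have "partial i (\<lambda>x. u (J - {i}) x + v (J - {i}) x) x =
      partial i (u (J - {i})) x + partial i (v (J - {i})) x" if "J \<subseteq> {..<m}" "i \<in> J" for i
    using partial_add[OF rformD(2)[OF assms(1)] rformD(2)[OF assms(2)], of i] that by auto
  then show "rd m (\<lambda>J x. u J x + v J x) J x = rd m u J x + rd m v J x"
    by (simp add: rd_def algebra_simps sum.distrib)
qed

section \<open>The homotopy in one even direction\<close>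

text \<open>One normalised bump per coordinate, with the same radius as the forms, so that
  projecting a form does not enlarge its support radius.\<close>

locale bumps =
  fixes m :: nat and R :: real and e :: "nat \<Rightarrow> (nat \<Rightarrow> real) \<Rightarrow> real"
  assumes R_nonneg: "0 \<le> R"
    and smooth_e: "i < m \<Longrightarrow> smooth m (e i)"
    and e_vanishes: "i < m \<Longrightarrow> R \<le> \<bar>x i\<bar> \<Longrightarrow> e i x = 0"
    and e_indep: "i < m \<Longrightarrow> j < m \<Longrightarrow> j \<noteq> i \<Longrightarrow> e i (x(j := t)) = e i x"
    and fint_e: "i < m \<Longrightarrow> fint R i (e i) x = 1"
begin

text \<open>The antiderivative of \<open>f - e_i \<integral> f dx_i\<close> in \<open>x_i\<close>, which is compactly supported since that
  difference has integral zero.\<close>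

definition Q :: "nat \<Rightarrow> ((nat \<Rightarrow> real) \<Rightarrow> real) \<Rightarrow> (nat \<Rightarrow> real) \<Rightarrow> real" where
  "Q i f x = aint R i f x - aint R i (e i) x * fint R i f x"

lemma csmooth_aint: "i < m \<Longrightarrow> csmooth m R f \<Longrightarrow> smooth m (aint R i f)"
  by (intro smooth_aint csmoothD(1)) (auto intro: csmoothD(2)[of m R f i])

lemma smooth_aint_e: "i < m \<Longrightarrow> smooth m (aint R i (e i))"
  by (intro smooth_aint smooth_e) (auto intro: e_vanishes)

text \<open>In direction i, both antiderivatives are 0 left of the support, and right of it they
  equal the full integrals and cancel because \<open>e i\<close> has integral 1. In any other
  direction f vanishes on the whole line of integration.\<close>

lemma csmooth_Q:
  assumes i: "i < m" and f: "csmooth m R f"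
  shows "csmooth m R (Q i f)"
  unfolding csmooth_def
proof (intro conjI allI impI)
  show "smooth m (Q i f)"
    unfolding Q_def[abs_def] using assms
    by (intro smooth_diff smooth_mult smooth_fint csmooth_aint smooth_aint_e csmoothD(1))
next
  fix x j assume j: "j < m" "R \<le> \<bar>x j\<bar>"
  show "Q i f x = 0"
  proof (cases "j = i")
    case True
    show ?thesis
    proof (cases "x i < 0")
      case True
      then have le: "x i \<le> -R" using j \<open>j = i\<close> by simp
      have "aint R i g x = 0" if "\<And>x. R \<le> \<bar>x i\<bar> \<Longrightarrow> g x = 0" for g
      proof (cases "x i = -R")
        case False
        then show ?thesis using le by (simp add: aint_def)
      qed (simp add: aint_def)
      then show ?thesis
        using csmoothD(2)[OF f i] e_vanishes[OF i] by (simp add: Q_def)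
    next
      case False
      then have "R \<le> x i" using j \<open>j = i\<close> by simp
      moreover have "f y = 0" "e i y = 0" if "R \<le> y i" for y
        using csmoothD(2)[OF f i, of y] e_vanishes[OF i, of y] that R_nonneg by auto
      ultimately have "aint R i f x = fint R i f x" "aint R i (e i) x = fint R i (e i) x"
        using R_nonneg smooth_continuous[OF csmoothD(1)[OF f]] smooth_continuous[OF smooth_e[OF i]]
        by (auto intro!: aint_ge)
      then show ?thesis
        using fint_e[OF i] by (simp add: Q_def)
    qed
  next
    case False
    then have "f (x(i := t)) = 0" for t
      using csmoothD(2)[OF f j(1)] j by simp
    then show ?thesis
      by (simp add: Q_def aint_def fint_def)
  qed
qed

text \<open>The correction term drops because a compactly supported derivative has integral 0. In
  the opposite order it survives and produces the projection.\<close>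

lemma Q_partial_self: "i < m \<Longrightarrow> csmooth m R f \<Longrightarrow> Q i (partial i f) = f"
  using fint_partial_self[of m f i R] aint_partial_self[of m f i R] csmoothD[of m R f]
  by (intro ext) (simp add: Q_def)

lemma partial_Q_self:
  assumes i: "i < m" and f: "csmooth m R f"
  shows "partial i (Q i f) = (\<lambda>x. f x - e i x * fint R i f x)"
proof -
  have "partial i (Q i f) = (\<lambda>x. partial i (aint R i f) x -
      (partial i (aint R i (e i)) x * fint R i f x + partial i (fint R i f) x * aint R i (e i) x))"
    unfolding Q_def[abs_def] using assms smooth_aint_e csmoothD(1)[OF f]
    by (simp add: partial_diff[of m] partial_mult[of m] smooth_mult smooth_fint csmooth_aint)
  moreover have "partial i (aint R i f) = f"
    using csmoothD(1)[OF f] csmoothD(2)[OF f i] by (intro partial_aint_self smooth_continuous) auto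
  moreover have "partial i (aint R i (e i)) = e i"
    using e_vanishes[OF i] smooth_e[OF i] by (intro partial_aint_self smooth_continuous) auto
  ultimately show ?thesis
    by (simp add: partial_fint_self)
qed

lemma partial_indep: "(\<And>x t. f (x(j := t)) = f x) \<Longrightarrow> partial j f = (\<lambda>x. 0)"
  by (intro ext partial_eqI) simp

text \<open>The antiderivative of \<open>e i\<close> does not depend on x_j, so differentiation acts
  on f alone.\<close>

lemma partial_Q:
  assumes i: "i < m" and j: "j < m" "j \<noteq> i" and f: "csmooth m R f"
  shows "partial j (Q i f) = Q i (partial j f)"
proof -
  have "partial j (aint R i (e i)) = (\<lambda>x. 0)"
  proof (rule partial_indep)
    fix x t
    have "e i (x(j := t, i := s)) = e i (x(i := s))" for s
      using e_indep[OF i j, of "x(i := s)"] j by (simp add: fun_upd_twist)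
    then show "aint R i (e i) (x(j := t)) = aint R i (e i) x"
      using j by (simp add: aint_def)
  qed
  moreover have "partial j (Q i f) = (\<lambda>x. partial j (aint R i f) x -
      (partial j (aint R i (e i)) x * fint R i f x + partial j (fint R i f) x * aint R i (e i) x))"
    unfolding Q_def[abs_def] using assms smooth_aint_e csmoothD(1)[OF f]
    by (simp add: partial_diff[of m] partial_mult[of m] smooth_mult smooth_fint csmooth_aint)
  ultimately show ?thesis
    using partial_aint[OF csmoothD(1)[OF f] j] partial_fint[OF csmoothD(1)[OF f] j]
    by (simp add: Q_def[abs_def] mult.commute)
qed

lemma Q_lincomb:
  assumes "\<And>a. a \<in> A \<Longrightarrow> smooth m (f a)"
  shows "Q i (\<lambda>x. \<Sum>a\<in>A. c a * f a x) = (\<lambda>x. \<Sum>a\<in>A. c a * Q i (f a) x)"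
  using aint_lincomb[of A f R i c] fint_lincomb[of A f R i c] assms smooth_continuous[of m]
  by (simp add: Q_def[abs_def] sum_distrib_left sum_subtractf algebra_simps)

lemma Q_0 [simp]: "Q i (\<lambda>x. 0) = (\<lambda>x. 0)"
  by (simp add: Q_def[abs_def])

text \<open>Contraction with the i-th coordinate field followed by \<open>Q\<close>; the sign comes
  from moving dx_i to the front of the product.\<close>

definition contr :: "nat \<Rightarrow> (nat set \<Rightarrow> (nat \<Rightarrow> real) \<Rightarrow> real) \<Rightarrow> nat set \<Rightarrow> (nat \<Rightarrow> real) \<Rightarrow> real" where
  "contr i u J = (if J \<subseteq> {..<m} \<and> i \<notin> J then \<lambda>x. ksgn J i * Q i (u (insert i J)) x else (\<lambda>x. 0))"

definition proj :: "nat \<Rightarrow> (nat set \<Rightarrow> (nat \<Rightarrow> real) \<Rightarrow> real) \<Rightarrow> nat set \<Rightarrow> (nat \<Rightarrow> real) \<Rightarrow> real" where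
  "proj i u J = (if i \<in> J then \<lambda>x. e i x * fint R i (u J) x else (\<lambda>x. 0))"

lemma rform_contr:
  assumes "i < m" "rform m R 0 k u"
  shows "rform m R 1 k (contr i u)"
  unfolding rform_def
proof (intro allI conjI impI)
  fix J
  show "csmooth m R (contr i u J)"
    using assms rformD(1)[OF assms(2)] by (auto simp: contr_def csmooth_0 intro!: csmooth_cmult csmooth_Q)
  assume "contr i u J \<noteq> (\<lambda>x. 0)"
  then have J: "J \<subseteq> {..<m}" "i \<notin> J" "u (insert i J) \<noteq> (\<lambda>x. 0)"
    by (auto simp: contr_def split: if_splits)
  then show "J \<subseteq> {..<m}" "card J + 1 = k"
    using rformD(3)[OF assms(2) J(3)] finite_subset[OF J(1)] by auto
qed

lemma rform_proj:
  assumes "i < m" "rform m R 0 k u"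
  shows "rform m R 0 k (proj i u)"
  unfolding rform_def
proof (intro allI conjI impI)
  fix J
  have "e i x * fint R i (u J) x = 0" if "j < m" "R \<le> \<bar>x j\<bar>" for j x
    using that e_vanishes[OF assms(1)] csmoothD(2)[OF rformD(1)[OF assms(2)] that(1)]
      fint_vanishes[of R j "u J" i x] by (cases "j = i") auto
  then show "csmooth m R (proj i u J)"
    using assms rformD[OF assms(2)] smooth_e
    by (auto simp: proj_def csmooth_0 csmooth_def intro!: smooth_mult smooth_fint smooth_const)
  assume "proj i u J \<noteq> (\<lambda>x. 0)"
  then have "u J \<noteq> (\<lambda>x. 0)"
    by (auto simp: proj_def split: if_splits)
  then show "J \<subseteq> {..<m}" "card J + 0 = k"
    using rformD(3)[OF assms(2)] by auto
qed

text \<open>The projection is a chain map: for i in J its differential at J is \<open>e i\<close>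
  times the integral of \<open>rd m u J\<close>. Indeed \<open>e i\<close> is constant in x_j for j
  different from i, and for j = i both sides contribute 0.\<close>

lemma rd_proj:
  assumes i: "i < m" and u: "rform m R 0 k u" and cl: "rd m u = (\<lambda>J x. 0)"
  shows "rd m (proj i u) = (\<lambda>J x. 0)"
proof (intro ext)
  fix J x
  show "rd m (proj i u) J x = 0"
  proof (cases "J \<subseteq> {..<m} \<and> i \<in> J")
    case False
    then show ?thesis
      by (simp add: rd_def proj_def partial_const)
  next
    case True
    have eq: "partial j (proj i u (J - {j})) x = e i x * fint R i (partial j (u (J - {j}))) x" if j: "j \<in> J" for j
    proof (cases "j = i")
      case True
      then show ?thesis
        using fint_partial_self[OF rformD(2)[OF u] i csmoothD(2)[OF rformD(1)[OF u] i]]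
        by (simp add: proj_def partial_const)
    next
      case False
      have "j < m" using j True by auto
      have "partial j (e i) = (\<lambda>x. 0)"
        using e_indep[OF i \<open>j < m\<close> False] by (rule partial_indep)
      then have "partial j (\<lambda>x. e i x * fint R i (u (J - {j})) x) =
          (\<lambda>x. partial j (fint R i (u (J - {j}))) x * e i x)"
        using partial_mult[OF smooth_e[OF i] smooth_fint[OF rformD(2)[OF u] i] \<open>j < m\<close>] by simp
      then show ?thesis
        using True False partial_fint[OF rformD(2)[OF u] \<open>j < m\<close> False] by (simp add: proj_def)
    qed
    have "fint R i (\<lambda>x. \<Sum>j\<in>J. ksgn J j * partial j (u (J - {j})) x) = fint R i (rd m u J)"
      using True by (simp add: rd_def[abs_def])
    moreover have "fint R i (\<lambda>x. \<Sum>j\<in>J. ksgn J j * partial j (u (J - {j})) x) =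
        (\<lambda>x. \<Sum>j\<in>J. ksgn J j * fint R i (partial j (u (J - {j}))) x)"
      using True rformD(2)[OF u] by (intro fint_lincomb smooth_continuous smooth_partial) auto
    ultimately have "(\<Sum>j\<in>J. ksgn J j * fint R i (partial j (u (J - {j}))) x) = 0"
      using cl by (simp add: fun_eq_iff)
    then have "(\<Sum>j\<in>J. e i x * (ksgn J j * fint R i (partial j (u (J - {j}))) x)) = 0"
      by (simp flip: sum_distrib_left)
    then show ?thesis
      using True eq by (simp add: rd_def mult.left_commute)
  qed
qed

text \<open>If i is in J, only j = i survives, since any other J - {j} still contains i;
  \<open>partial_Q_self\<close> then gives the identity minus the projection. If i is not in J,
  closedness at \<open>insert i J\<close> recovers the coefficient.\<close>

lemma rd_contr:
  assumes i: "i < m" and u: "rform m R 0 k u" and cl: "rd m u = (\<lambda>J x. 0)"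
  shows "rd m (contr i u) = (\<lambda>J x. u J x - proj i u J x)"
proof (intro ext)
  fix J x
  show "rd m (contr i u) J x = u J x - proj i u J x"
  proof (cases "J \<subseteq> {..<m}")
    case False
    then have "u J = (\<lambda>x. 0)"
      using rformD(3)[OF u] by blast
    then show ?thesis
      using False by (simp add: rd_def proj_def)
  next
    case J: True
    then have fin: "finite J" using finite_subset by blast
    note Qs = csmoothD(1)[OF csmooth_Q[OF i rformD(1)[OF u]]]
    show ?thesis
    proof (cases "i \<in> J")
      case True
      have "rd m (contr i u) J x = (\<Sum>j\<in>J. ksgn J j * partial j (contr i u (J - {j})) x)"
        using J by (simp add: rd_def)
      also have "\<dots> = ksgn J i * partial i (contr i u (J - {i})) x"
        using True fin
        by (intro trans[OF sum.mono_neutral_right[of J "{i}"]]) (auto simp: contr_def partial_const)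
      also have "contr i u (J - {i}) = (\<lambda>x. ksgn J i * Q i (u J) x)"
        using True J fin by (auto simp: contr_def insert_absorb ksgn_remove)
      also have "ksgn J i * partial i \<dots> x = partial i (Q i (u J)) x"
        using partial_cmult[OF Qs i] by simp
      finally show ?thesis
        using True partial_Q_self[OF i rformD(1)[OF u]] by (simp add: proj_def)
    next
      case False
      have "partial j (contr i u (J - {j})) x =
          ksgn (J - {j}) i * Q i (partial j (u (insert i (J - {j})))) x" if "j \<in> J" for j
      proof -
        have j: "j < m" "j \<noteq> i" using that J False by auto
        show ?thesis
          using J False partial_cmult[OF Qs j(1)] partial_Q[OF i j rformD(1)[OF u]]
          by (auto simp: contr_def)
      qed
      then have "rd m (contr i u) J x =
          (\<Sum>j\<in>J. ksgn J j * (ksgn (J - {j}) i * Q i (partial j (u (insert i (J - {j})))) x))"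
        using J by (simp add: rd_def)
      \<comment> \<open>Exactly one of i < j and j < i holds, so exactly one of inserting i and
        removing j flips a sign.\<close>
      also have "\<dots> = (\<Sum>j\<in>J. - ksgn J i * (ksgn (insert i J) j * Q i (partial j (u (insert i J - {j}))) x))"
      proof (rule sum.cong)
        fix j assume j: "j \<in> J"
        then have "insert i (J - {j}) = insert i J - {j}" "i \<noteq> j" using False by auto
        then show "ksgn J j * (ksgn (J - {j}) i * Q i (partial j (u (insert i (J - {j})))) x) =
            - ksgn J i * (ksgn (insert i J) j * Q i (partial j (u (insert i J - {j}))) x)"
          using j fin False by (auto simp: ksgn_insert ksgn_remove)
      qed simp
      also have "\<dots> = - ksgn J i * (\<Sum>j\<in>J. ksgn (insert i J) j * Q i (partial j (u (insert i J - {j}))) x)"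
        by (simp add: sum_distrib_left)
      also have "(\<Sum>j\<in>J. ksgn (insert i J) j * Q i (partial j (u (insert i J - {j}))) x) = - ksgn J i * u J x"
      proof -
        \<comment> \<open>Apply \<open>Q i\<close> to the closedness equation at
          \<open>insert i J\<close>; its summand j = i is u J up to sign.\<close>
        have "(\<lambda>x. \<Sum>j\<in>insert i J. ksgn (insert i J) j * Q i (partial j (u (insert i J - {j}))) x) =
          Q i (\<lambda>x. \<Sum>j\<in>insert i J. ksgn (insert i J) j * partial j (u (insert i J - {j})) x)"
          using i J rformD(2)[OF u] by (intro Q_lincomb[symmetric] smooth_partial) auto
        also have "\<dots> = Q i (rd m u (insert i J))"
          using i J by (simp add: rd_def[abs_def])
        finally have "(\<Sum>j\<in>insert i J. ksgn (insert i J) j * Q i (partial j (u (insert i J - {j}))) x) = 0"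
          using cl by (simp add: fun_eq_iff)
        moreover have "insert i J - {i} = J" using False by auto
        ultimately show ?thesis
          using fin False Q_partial_self[OF i rformD(1)[OF u]] by (simp add: ksgn_insert)
      qed
      finally show ?thesis
        using False by (simp add: proj_def)
    qed
  qed
qed

text \<open>\<open>js\<close> lists the coordinates still to be treated. Nonzero components contain
  all treated ones, and the integral of the top coefficient over the rest vanishes. When the list is
  empty, only the top component could remain, and it is 0.\<close>

lemma rexact:
  assumes "distinct js" "set js \<subseteq> {..<m}" "rform m R 0 k u" "rd m u = (\<lambda>J x. 0)"
    and "\<And>J. u J \<noteq> (\<lambda>x. 0) \<Longrightarrow> {..<m} - set js \<subseteq> J"
    and "iint R js (u {..<m}) = (\<lambda>x. 0)"
  shows "\<exists>v. rform m R 1 k v \<and> rd m v = u"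
  using assms
proof (induction js arbitrary: u)
  case Nil
  have "u J = (\<lambda>x. 0)" for J
  proof (rule ccontr)
    assume J: "u J \<noteq> (\<lambda>x. 0)"
    then have "J = {..<m}"
      using Nil.prems(5)[OF J] rformD(3)[OF Nil.prems(3) J] by auto
    then show False using J Nil.prems(6) by simp
  qed
  then have "u = (\<lambda>J x. 0)" by (simp add: fun_eq_iff)
  then show ?case
    by (intro exI[of _ "\<lambda>J x. 0"]) (auto simp: rform_def csmooth_0 rd_def fun_eq_iff partial_const)
next
  case (Cons i js)
  then have i: "i < m" by simp
  have "\<exists>v. rform m R 1 k v \<and> rd m v = proj i u"
  proof (rule Cons.IH)
    show "rform m R 0 k (proj i u)" "rd m (proj i u) = (\<lambda>J x. 0)"
      using Cons.prems i rform_proj rd_proj by auto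
    fix J assume "proj i u J \<noteq> (\<lambda>x. 0)"
    then have "i \<in> J" "u J \<noteq> (\<lambda>x. 0)"
      by (auto simp: proj_def split: if_splits)
    then show "{..<m} - set js \<subseteq> J"
      using Cons.prems(5)[of J] by auto
  next
    \<comment> \<open>As the list is distinct, \<open>e i\<close> is constant in the remaining
      coordinates and factors out of their integrals.\<close>
    have "e i (x(j := t)) = e i x" if "j \<in> set js" for j x t
      using that Cons.prems i by (intro e_indep) auto
    then have "iint R js (\<lambda>x. e i x * fint R i (u {..<m}) x) =
        (\<lambda>x. e i x * iint R js (fint R i (u {..<m})) x)"
      by (rule iint_mult_indep)
    then show "iint R js (proj i u {..<m}) = (\<lambda>x. 0)"
      using Cons.prems(6) i by (simp add: proj_def)
  qed (use Cons.prems in auto)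
  then obtain v where v: "rform m R 1 k v" "rd m v = proj i u" by blast
  have "rd m (\<lambda>J x. contr i u J x + v J x) = u"
    using rd_add[OF rform_contr[OF i Cons.prems(3)] v(1)] rd_contr[OF i Cons.prems(3,4)] v(2) by simp
  then show ?case
    using rform_add[OF rform_contr[OF i Cons.prems(3)] v(1)] by blast
qed

end

lemma bumps_of_form:
  assumes "0 \<le> R" "csmooth m R B" "integral_Rm m B = 1"
  shows "bumps m R (\<lambda>i. iint R (removeAll i (rev [0..<m])) B)"
proof
  fix i assume i: "i < m"
  show "smooth m (iint R (removeAll i (rev [0..<m])) B)"
    by (rule smooth_iint[OF _ csmoothD(1)[OF assms(2)]]) auto
  show "iint R (removeAll i (rev [0..<m])) B x = 0" if "R \<le> \<bar>x i\<bar>" for x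
    by (rule iint_vanishes[of i]) (use csmoothD(2)[OF assms(2) i] that in auto)
  show "iint R (removeAll i (rev [0..<m])) B (x(j := t)) = iint R (removeAll i (rev [0..<m])) B x"
    if "j < m" "j \<noteq> i" for j x t
    by (rule iint_indep) (use that in auto)
  have "fint R i (iint R (removeAll i (rev [0..<m])) B) x = iint R (rev [0..<m]) B x" for x
    using i csmoothD(1)[OF assms(2)] by (subst fint_iint_removeAll[of _ m]) auto
  also have "iint R (rev [0..<m]) B x = iint R (rev [0..<m]) B (\<lambda>_. 0)" for x
  proof (rule eq_at_zero)
    show "iint R (rev [0..<m]) B (trunc m x) = iint R (rev [0..<m]) B x" for x
      by (rule smooth_trunc[OF smooth_iint[OF _ csmoothD(1)[OF assms(2)]]]) auto
  qed (rule iint_indep, auto)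
  also have "\<dots> = integral_Rm m B"
    using csmoothD[OF assms(2)] by (intro integral_Rm_eq_iint[symmetric] smooth_continuous)
  finally show "fint R i (iint R (removeAll i (rev [0..<m])) B) x = 1" for x
    using assms(3) by simp
qed (rule assms(1))

section \<open>Eliminating the odd coordinates\<close>

text \<open>The degree shift of \<open>rform\<close> for superforms. Radii may vary with the
  coefficient here, since the odd homotopy involves no integration.\<close>

definition cform_shift :: "nat \<Rightarrow> nat \<Rightarrow> nat \<Rightarrow> nat \<Rightarrow> sform \<Rightarrow> bool" where
  "cform_shift m n s k c \<longleftrightarrow>
     (\<forall>I J b. c I J b \<noteq> (\<lambda>x. 0) \<longrightarrow> valid_idx m n I J b \<and> fdeg n J b + s = k) \<and>
     (\<forall>I J b. smooth m (c I J b) \<and> csupp m (c I J b))"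

lemma cform_iff_shift: "cform m n k c \<longleftrightarrow> cform_shift m n 0 k c"
  by (simp add: cform_def cform_shift_def)

lemma csupp_0: "csupp m (\<lambda>x. 0)"
  by (simp add: csupp_def)

lemma csupp_cmult: "csupp m f \<Longrightarrow> csupp m (\<lambda>x. c * f x)"
  by (auto simp: csupp_def)

lemma csupp_add:
  assumes "csupp m f" "csupp m g"
  shows "csupp m (\<lambda>x. f x + g x)"
proof -
  obtain R S where R: "\<forall>x\<in>pts m. f x \<noteq> 0 \<longrightarrow> (\<forall>i<m. \<bar>x i\<bar> \<le> R)"
    and S: "\<forall>x\<in>pts m. g x \<noteq> 0 \<longrightarrow> (\<forall>i<m. \<bar>x i\<bar> \<le> S)"
    using assms unfolding csupp_def by blast
  have "\<bar>x i\<bar> \<le> max R S" if "x \<in> pts m" "f x + g x \<noteq> 0" "i < m" for x i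
  proof (cases "f x = 0")
    case True
    then have "g x \<noteq> 0" using that by simp
    then show ?thesis using S that by (simp add: le_max_iff_disj)
  next
    case False
    then show ?thesis using R that by (simp add: le_max_iff_disj)
  qed
  then show ?thesis unfolding csupp_def by blast
qed

lemma csupp_sum: "(\<And>a. a \<in> A \<Longrightarrow> csupp m (f a)) \<Longrightarrow> csupp m (\<lambda>x. \<Sum>a\<in>A. f a x)"
  by (induction A rule: infinite_finite_induct) (auto intro: csupp_0 csupp_add)

lemma csmooth_csupp: "csmooth m R f \<Longrightarrow> csupp m f"
  unfolding csmooth_def csupp_def by (intro exI[of _ R]) (auto simp: not_le intro: less_imp_le leI)

lemma csupp_csmooth:
  assumes "smooth m f" "csupp m f"
  shows "\<exists>R. csmooth m R f"
proof -
  obtain R where R: "\<forall>x\<in>pts m. f x \<noteq> 0 \<longrightarrow> (\<forall>i<m. \<bar>x i\<bar> \<le> R)"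
    using assms(2) unfolding csupp_def by blast
  \<comment> \<open>The bound from \<open>csupp\<close> is attained, so 1 is added to have f vanish
    from the new radius on; truncation carries the bound from \<open>pts m\<close> to all
    points.\<close>
  have "f x = 0" if "i < m" "R + 1 \<le> \<bar>x i\<bar>" for x i
  proof (rule ccontr)
    assume "f x \<noteq> 0"
    then have "f (trunc m x) \<noteq> 0"
      using smooth_trunc[OF assms(1)] by simp
    then have "\<bar>trunc m x i\<bar> \<le> R"
      using R trunc_in_pts that(1) by blast
    then show False using that by (simp add: trunc_def)
  qed
  then show ?thesis
    using assms(1) unfolding csmooth_def by blast
qed

lemma csmooth_uniform:
  assumes "finite A" "\<And>a. a \<in> A \<Longrightarrow> \<exists>R. csmooth m R (f a)"
  shows "\<exists>R\<ge>0. \<forall>a\<in>A. csmooth m R (f a)"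
  using assms
proof (induction A)
  case (insert a A)
  then obtain R where "R \<ge> 0" "\<forall>a\<in>A. csmooth m R (f a)" by blast
  moreover obtain S where "csmooth m S (f a)" using insert.prems by blast
  ultimately show ?case
    by (intro exI[of _ "max R S"]) (auto intro: csmooth_mono)
qed auto

lemma cform_shiftD:
  assumes "cform_shift m n s k c"
  shows "smooth m (c I J b)" "csupp m (c I J b)"
    "c I J b \<noteq> (\<lambda>x. 0) \<Longrightarrow> valid_idx m n I J b \<and> fdeg n J b + s = k"
  using assms by (auto simp: cform_shift_def)

lemma cform_shift_add:
  assumes "cform_shift m n s k c" "cform_shift m n s k d"
  shows "cform_shift m n s k (\<lambda>I J b x. c I J b x + d I J b x)"
proof -
  have "valid_idx m n I J b \<and> fdeg n J b + s = k" if "(\<lambda>x. c I J b x + d I J b x) \<noteq> (\<lambda>x. 0)" for I J b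
    using that cform_shiftD(3)[OF assms(1), of I J b] cform_shiftD(3)[OF assms(2), of I J b] by fastforce
  then show ?thesis
    using assms by (simp add: cform_shift_def smooth_add csupp_add)
qed

lemma dform_ksgn: "dform m n c = (\<lambda>I J b x.
     if valid_idx m n I J b then
       (\<Sum>i\<in>J. (-1) ^ card I * ksgn J i * partial i (c I (J - {i}) b) x)
       + (\<Sum>a\<in>{a. a < n \<and> a \<notin> I \<and> 0 < b a}. ksgn I a * c (insert a I) J (b(a := b a - 1)) x)
     else 0)"
  unfolding dform_def ksgn_def power_add ..

lemma dform_add:
  assumes "cform_shift m n s k c" "cform_shift m n s k d"
  shows "dform m n (\<lambda>I J b x. c I J b x + d I J b x) = (\<lambda>I J b x. dform m n c I J b x + dform m n d I J b x)"
proof (intro ext)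
  fix I J b x
  have "partial i (\<lambda>x. c I (J - {i}) b x + d I (J - {i}) b x) x =
      partial i (c I (J - {i}) b) x + partial i (d I (J - {i}) b) x"
    if "valid_idx m n I J b" "i \<in> J" for i
    using partial_add[OF cform_shiftD(1)[OF assms(1)] cform_shiftD(1)[OF assms(2)], of i] that
    by (auto simp: valid_idx_def)
  then show "dform m n (\<lambda>I J b x. c I J b x + d I J b x) I J b x = dform m n c I J b x + dform m n d I J b x"
    by (simp add: dform_ksgn algebra_simps sum.distrib)
qed

lemma dform_0: "dform m n (\<lambda>I J b x. 0) = (\<lambda>I J b x. 0)"
  by (intro ext) (simp add: dform_def partial_const)

text \<open>For k = 0 the shifted degree condition is unsatisfiable, so e and hence c vanish, in
  agreement with the separate clause of \<open>exact_form\<close>.\<close>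

lemma exact_formI:
  assumes "cform_shift m n 1 k e" "dform m n e = c"
  shows "exact_form m n k c"
proof (cases "k = 0")
  case True
  then have "e I J b = (\<lambda>x. 0)" for I J b
    using cform_shiftD(3)[OF assms(1), of I J b] by auto
  then have "e = (\<lambda>I J b x. 0)" by (simp add: fun_eq_iff)
  then have "c = (\<lambda>I J b x. 0)"
    using assms(2) dform_0 by simp
  with True show ?thesis by (simp add: exact_form_def)
next
  case False
  then have "fdeg n J b + 1 = k \<longleftrightarrow> fdeg n J b = k - 1" for J b
    by auto
  then have "cform m n (k - 1) e"
    using assms(1) by (simp add: cform_def cform_shift_def)
  with False assms(2) show ?thesis by (auto simp: exact_form_def)
qed

text \<open>The Koszul homotopy \<open>\<Sum>\<^sub>a \<theta>\<^sub>a \<partial>/\<partial>(d\<theta>\<^sub>a)\<close>, divided by the weight \<open>|I| + |b|\<close>, which the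
  differential and the homotopy preserve. In weight 0 the sum is empty, so \<open>0/0\<close> is harmless.\<close>

definition wt :: "nat \<Rightarrow> nat set \<Rightarrow> (nat \<Rightarrow> nat) \<Rightarrow> nat" where
  "wt n I b = card I + (\<Sum>a<n. b a)"

definition kosz :: "nat \<Rightarrow> sform \<Rightarrow> sform" where
  "kosz n c I J b x =
    (\<Sum>a\<in>I. ksgn I a * (real (b a) + 1) / real (wt n I b) * c (I - {a}) J (b(a := Suc (b a))) x)"

lemma cform_kosz:
  assumes "cform_shift m n 0 k c"
  shows "cform_shift m n 1 k (kosz n c)"
  unfolding cform_shift_def
proof (intro conjI allI impI)
  fix I J b
  show "smooth m (kosz n c I J b)"
    unfolding kosz_def[abs_def]
    by (rule smooth_sum, rule smooth_cmult, rule cform_shiftD(1)[OF assms])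
  show "csupp m (kosz n c I J b)"
    unfolding kosz_def[abs_def]
    by (rule csupp_sum, rule csupp_cmult, rule cform_shiftD(2)[OF assms])
  assume "kosz n c I J b \<noteq> (\<lambda>x. 0)"
  then obtain x where "kosz n c I J b x \<noteq> 0" by blast
  then obtain a where a: "a \<in> I" "c (I - {a}) J (b(a := Suc (b a))) x \<noteq> 0"
    unfolding kosz_def by (metis (no_types, lifting) mult_zero_right sum.neutral)
  then have v: "valid_idx m n (I - {a}) J (b(a := Suc (b a)))" "fdeg n J (b(a := Suc (b a))) = k"
    using cform_shiftD(3)[OF assms, of "I - {a}" J "b(a := Suc (b a))"] by (auto simp: fun_eq_iff)
  \<comment> \<open>The raised exponent at a is positive, which a valid index permits only below
    n.\<close>
  have an: "a < n"
    using v(1) by (auto simp: valid_idx_def not_less[symmetric] split: if_splits)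
  then show "valid_idx m n I J b"
    using v(1) by (auto simp: valid_idx_def split: if_splits)
  show "fdeg n J b + 1 = k"
    using v(2) an by (simp add: fdeg_def sum.remove[of "{..<n}" a])
qed

lemma valid_idx_shift:
  assumes "valid_idx m n I J b" "a \<in> I"
  shows "valid_idx m n (I - {a}) J (b(a := Suc (b a)))"
  using assms by (auto simp: valid_idx_def)

text \<open>Closedness turns the even derivatives of the homotopy into odd terms. Trading theta_p
  for theta_a with a different from p cancels between the two halves of the differential. The
  diagonal terms count \<open>b p\<close> + 1 for p in I (from differentiating a power of dtheta_p)
  and \<open>b a\<close> for a outside I, in total the weight.\<close>

lemma dform_kosz:
  assumes c: "cform_shift m n 0 k c" and cl: "dform m n c = (\<lambda>I J b x. 0)"
  shows "dform m n (kosz n c) = (\<lambda>I J b x. if wt n I b = 0 then 0 else c I J b x)"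
proof (intro ext)
  fix I J b x
  show "dform m n (kosz n c) I J b x = (if wt n I b = 0 then 0 else c I J b x)"
  proof (cases "valid_idx m n I J b")
    case False
    then have "c I J b = (\<lambda>x. 0)" using cform_shiftD(3)[OF c] by blast
    then show ?thesis using False by (simp add: dform_def)
  next
    case v: True
    then have In: "I \<subseteq> {..<n}" and J: "J \<subseteq> {..<m}" by (auto simp: valid_idx_def)
    then have fin: "finite I" "finite J" using finite_subset by blast+
    define A where "A = {a. a < n \<and> a \<notin> I \<and> 0 < b a}"
    have finA: "finite A" by (simp add: A_def)
    define N where "N = real (wt n I b)"
    define up where "up p = b(p := Suc (b p))" for p
    \<comment> \<open>The off-diagonal terms, in which p leaves I and a enters; they appear with
      sign + in \<open>S1\<close> and - in \<open>S2\<close>.\<close>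
    define X where "X p a = ksgn I p * (real (b p) + 1) / N *
       (ksgn (I - {p}) a * c (insert a (I - {p})) J ((up p)(a := b a - 1)) x)" for p a
    have Ip: "(-1) ^ card (I - {p}) = - ((-1) ^ card I :: real)" if "p \<in> I" for p
    proof -
      have "card I = Suc (card (I - {p}))" using that fin by (metis card_Suc_Diff1)
      then show ?thesis by simp
    qed
    \<comment> \<open>Closedness at (I - {p}, J, \<open>up p\<close>): its odd summand a = p is c I
      J b, and dropping p from I flips the sign of the even part.\<close>
    have closed: "(\<Sum>i\<in>J. (-1) ^ card I * ksgn J i * partial i (c (I - {p}) (J - {i}) (up p)) x) =
        ksgn I p * c I J b x + (\<Sum>a\<in>A. ksgn (I - {p}) a * c (insert a (I - {p})) J ((up p)(a := b a - 1)) x)"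
      if p: "p \<in> I" for p
    proof -
      have "{a. a < n \<and> a \<notin> I - {p} \<and> 0 < up p a} = insert p A" "p \<notin> A"
        using p In by (auto simp: up_def A_def)
      moreover have "(\<Sum>a\<in>A. ksgn (I - {p}) a * c (insert a (I - {p})) J ((up p)(a := up p a - 1)) x) =
          (\<Sum>a\<in>A. ksgn (I - {p}) a * c (insert a (I - {p})) J ((up p)(a := b a - 1)) x)"
        using p by (intro sum.cong) (auto simp: up_def A_def)
      moreover have "dform m n c (I - {p}) J (up p) x = 0"
        using cl by simp
      ultimately have "(\<Sum>i\<in>J. (-1) ^ card (I - {p}) * ksgn J i * partial i (c (I - {p}) (J - {i}) (up p)) x) +
        (ksgn (I - {p}) p * c (insert p (I - {p})) J ((up p)(p := up p p - 1)) x +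
        (\<Sum>a\<in>A. ksgn (I - {p}) a * c (insert a (I - {p})) J ((up p)(a := b a - 1)) x)) = 0"
        using valid_idx_shift[OF v p] finA by (simp add: dform_ksgn up_def)
      moreover have "ksgn (I - {p}) p = ksgn I p" "insert p (I - {p}) = I" "(up p)(p := up p p - 1) = b"
        using p fin by (auto simp: ksgn_remove up_def)
      moreover have "(\<Sum>i\<in>J. (-1) ^ card (I - {p}) * ksgn J i * partial i (c (I - {p}) (J - {i}) (up p)) x) =
          - (\<Sum>i\<in>J. (-1) ^ card I * ksgn J i * partial i (c (I - {p}) (J - {i}) (up p)) x)"
        unfolding Ip[OF p] by (simp add: sum_negf)
      ultimately show ?thesis
        by (simp only:)
    qed
    have "(\<Sum>i\<in>J. (-1) ^ card I * ksgn J i * partial i (kosz n c I (J - {i}) b) x) =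
        (\<Sum>i\<in>J. (-1) ^ card I * ksgn J i *
          (\<Sum>p\<in>I. ksgn I p * (real (b p) + 1) / N * partial i (c (I - {p}) (J - {i}) (up p)) x))"
    proof (rule sum.cong)
      fix i assume "i \<in> J"
      then have i: "i < m" using J by auto
      have "partial i (kosz n c I (J - {i}) b) = (\<lambda>x. \<Sum>p\<in>I.
          partial i (\<lambda>x. ksgn I p * (real (b p) + 1) / N * c (I - {p}) (J - {i}) (up p) x) x)"
        unfolding kosz_def[abs_def] N_def up_def using i
        by (intro partial_sum smooth_cmult) (simp_all add: cform_shiftD(1)[OF c])
      also have "\<dots> = (\<lambda>x. \<Sum>p\<in>I.
          ksgn I p * (real (b p) + 1) / N * partial i (c (I - {p}) (J - {i}) (up p)) x)"
        by (simp only: partial_cmult[OF cform_shiftD(1)[OF c] i])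
      finally show "(-1) ^ card I * ksgn J i * partial i (kosz n c I (J - {i}) b) x =
        (-1) ^ card I * ksgn J i *
          (\<Sum>p\<in>I. ksgn I p * (real (b p) + 1) / N * partial i (c (I - {p}) (J - {i}) (up p)) x)"
        by simp
    qed simp
    also have "\<dots> = (\<Sum>p\<in>I. ksgn I p * (real (b p) + 1) / N *
        (\<Sum>i\<in>J. (-1) ^ card I * ksgn J i * partial i (c (I - {p}) (J - {i}) (up p)) x))"
      unfolding sum_distrib_left by (subst sum.swap) (simp add: mult_ac)
    also have "\<dots> = (\<Sum>p\<in>I. (real (b p) + 1) / N * c I J b x + (\<Sum>a\<in>A. X p a))"
    proof (rule sum.cong)
      fix p assume "p \<in> I"
      have "s * y / N * (s * z + S) = s * s * (y / N * z) + s * y / N * S" for s y z S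
        by (simp add: divide_inverse algebra_simps)
      then show "ksgn I p * (real (b p) + 1) / N *
        (\<Sum>i\<in>J. (-1) ^ card I * ksgn J i * partial i (c (I - {p}) (J - {i}) (up p)) x) =
        (real (b p) + 1) / N * c I J b x + (\<Sum>a\<in>A. X p a)"
        unfolding closed[OF \<open>p \<in> I\<close>] X_def sum_distrib_left[symmetric] by simp
    qed simp
    finally have S1: "(\<Sum>i\<in>J. (-1) ^ card I * ksgn J i * partial i (kosz n c I (J - {i}) b) x) =
      (\<Sum>p\<in>I. (real (b p) + 1) / N * c I J b x) + (\<Sum>p\<in>I. \<Sum>a\<in>A. X p a)"
      by (simp add: sum.distrib)
    have "ksgn I a * kosz n c (insert a I) J (b(a := b a - 1)) x =
        real (b a) / N * c I J b x - (\<Sum>p\<in>I. X p a)" if a: "a \<in> A" for a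
    proof -
      have a': "a \<notin> I" "a < n" "0 < b a" using a by (auto simp: A_def)
      have "(\<Sum>a<n. b a) = Suc (\<Sum>i<n. (b(a := b a - 1)) i)"
        using a' by (simp add: sum.remove[of "{..<n}" a])
      \<comment> \<open>The index reached has the same weight, so the same divisor N occurs.\<close>
      then have wt: "wt n (insert a I) (b(a := b a - 1)) = wt n I b"
        using a' fin by (simp add: wt_def)
      have "ksgn I a * kosz n c (insert a I) J (b(a := b a - 1)) x =
         ksgn I a * (ksgn I a * real (b a) / N * c I J b x) +
         (\<Sum>p\<in>I. ksgn I a * (ksgn (insert a I) p * (real (b p) + 1) / N *
            c (insert a I - {p}) J (b(a := b a - 1, p := Suc (b p))) x))"
      proof -
        have "insert a I - {a} = I" "b(a := b a - 1, a := Suc ((b(a := b a - 1)) a)) = b"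
          using a' by auto
        moreover have "(\<Sum>p\<in>I. ksgn (insert a I) p * (real ((b(a := b a - 1)) p) + 1) / N *
            c (insert a I - {p}) J (b(a := b a - 1, p := Suc ((b(a := b a - 1)) p))) x) =
           (\<Sum>p\<in>I. ksgn (insert a I) p * (real (b p) + 1) / N *
            c (insert a I - {p}) J (b(a := b a - 1, p := Suc (b p))) x)"
          using a' by (intro sum.cong) auto
        moreover have "real ((b(a := b a - 1)) a) + 1 = real (b a)"
          using a' by simp
        moreover have "ksgn (insert a I) a = ksgn I a"
          using a' fin by (simp add: ksgn_insert)
        ultimately show ?thesis
          unfolding kosz_def wt N_def[symmetric] sum.insert[OF fin(1) a'(1)]
          by (simp only: distrib_left sum_distrib_left)
      qed
      also have "(\<Sum>p\<in>I. ksgn I a * (ksgn (insert a I) p * (real (b p) + 1) / N *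
            c (insert a I - {p}) J (b(a := b a - 1, p := Suc (b p))) x)) = (\<Sum>p\<in>I. - X p a)"
      proof (rule sum.cong)
        fix p assume p: "p \<in> I"
        then have "p \<noteq> a" using a' by auto
        then have eq: "insert a I - {p} = insert a (I - {p})"
          "b(a := b a - 1, p := Suc (b p)) = (up p)(a := b a - 1)"
          by (auto simp: up_def)
        \<comment> \<open>Opposite signs because exactly one of a < p and p < a holds.\<close>
        have "ksgn I a * ksgn (insert a I) p = - (ksgn I p * ksgn (I - {p}) a)"
          using p a' fin \<open>p \<noteq> a\<close> by (auto simp: ksgn_insert ksgn_remove)
        then have "ksgn I a * ksgn (insert a I) p * z = - (ksgn I p * ksgn (I - {p}) a) * z" for z
          by simp
        from this[of "(real (b p) + 1) / N * c (insert a (I - {p})) J ((up p)(a := b a - 1)) x"]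
        show "ksgn I a * (ksgn (insert a I) p * (real (b p) + 1) / N *
            c (insert a I - {p}) J (b(a := b a - 1, p := Suc (b p))) x) = - X p a"
          unfolding eq X_def by (simp add: mult_ac)
      qed simp
      also have "ksgn I a * (ksgn I a * real (b a) / N * c I J b x) = real (b a) / N * c I J b x"
        by (simp add: divide_inverse mult.assoc)
      finally show ?thesis
        by (simp only: sum_negf add_uminus_conv_diff)
    qed
    then have S2: "(\<Sum>a\<in>A. ksgn I a * kosz n c (insert a I) J (b(a := b a - 1)) x) =
        (\<Sum>a\<in>A. real (b a) / N * c I J b x) - (\<Sum>p\<in>I. \<Sum>a\<in>A. X p a)"
      by (simp add: sum_subtractf sum.swap[of X A I])
    \<comment> \<open>Below n, exponents outside I and A are 0.\<close>
    have "(\<Sum>a<n. b a) = (\<Sum>a\<in>I \<union> A. b a)"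
      using In by (intro sum.mono_neutral_right) (auto simp: A_def)
    also have "\<dots> = (\<Sum>a\<in>I. b a) + (\<Sum>a\<in>A. b a)"
      using fin finA by (intro sum.union_disjoint) (auto simp: A_def)
    finally have N: "N = (\<Sum>p\<in>I. real (b p) + 1) + (\<Sum>a\<in>A. real (b a))"
      by (simp add: N_def wt_def sum.distrib)
    have "dform m n (kosz n c) I J b x =
      (\<Sum>p\<in>I. (real (b p) + 1) / N * c I J b x) + (\<Sum>a\<in>A. real (b a) / N * c I J b x)"
      using v S1 S2 by (simp add: dform_ksgn A_def)
    also have "\<dots> = ((\<Sum>p\<in>I. real (b p) + 1) + (\<Sum>a\<in>A. real (b a))) / N * c I J b x"
      by (simp only: sum_divide_distrib sum_distrib_right add_divide_distrib distrib_right)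
    also have "\<dots> = N / N * c I J b x"
      by (simp only: N[symmetric])
    \<comment> \<open>N / N is 1 for positive weight and, by the convention for division by zero, 0
      for weight 0; this is the case split claimed.\<close>
    finally show ?thesis
      by (simp add: N_def)
  qed
qed

section \<open>Passing between R^(m|n) and R^m\<close>

text \<open>Pullback along the projection from R^(m|n) to R^m.\<close>

definition emb :: "(nat set \<Rightarrow> (nat \<Rightarrow> real) \<Rightarrow> real) \<Rightarrow> sform" where
  "emb u I J b = (if I = {} \<and> b = (\<lambda>_. 0) then u J else (\<lambda>x. 0))"

text \<open>Restriction to R^m commutes with the differentials: with all exponents 0 the odd sum is
  empty.\<close>

lemma rd_weight_zero: "rd m (\<lambda>J. c {} J (\<lambda>_. 0)) J x = dform m n c {} J (\<lambda>_. 0) x"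
  by (simp add: rd_def dform_ksgn valid_idx_def)

lemma dform_emb: "dform m n (emb u) = emb (rd m u)"
proof (intro ext)
  fix I J b x
  show "dform m n (emb u) I J b x = emb (rd m u) I J b x"
  proof (cases "I = {} \<and> b = (\<lambda>_. 0)")
    case True
    then show ?thesis by (simp add: dform_ksgn emb_def rd_def valid_idx_def)
  next
    case False
    then have "emb u I J' b = (\<lambda>x. 0)" "emb u (insert a I) J' b' = (\<lambda>x. 0)" for J' a b'
      by (auto simp: emb_def)
    moreover have "emb (rd m u) I J b = (\<lambda>x. 0)"
      using False by (auto simp: emb_def)
    ultimately show ?thesis by (simp add: dform_ksgn partial_const)
  qed
qed

lemma cform_emb:
  assumes "rform m R s k v"
  shows "cform_shift m n s k (emb v)"
  unfolding cform_shift_def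
proof (intro conjI allI impI)
  fix I J b
  show "smooth m (emb v I J b)" "csupp m (emb v I J b)"
    using rformD(2)[OF assms] csmooth_csupp[OF rformD(1)[OF assms]]
    by (auto simp: emb_def smooth_const csupp_0)
  assume "emb v I J b \<noteq> (\<lambda>x. 0)"
  then have "I = {}" "b = (\<lambda>_. 0)" "v J \<noteq> (\<lambda>x. 0)"
    by (auto simp: emb_def split: if_splits)
  then show "valid_idx m n I J b" "fdeg n J b + s = k"
    using rformD(3)[OF assms, of J] by (auto simp: valid_idx_def fdeg_def)
qed

lemma weight_zero_iff: "valid_idx m n I J b \<Longrightarrow> wt n I b = 0 \<longleftrightarrow> I = {} \<and> b = (\<lambda>_. 0)"
proof -
  assume v: "valid_idx m n I J b"
  then have "finite I" using finite_subset by (auto simp: valid_idx_def)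
  moreover have "(\<forall>a<n. b a = 0) \<longleftrightarrow> b = (\<lambda>_. 0)"
    using v by (auto simp: valid_idx_def fun_eq_iff) (metis not_less)
  ultimately show ?thesis by (auto simp: wt_def)
qed

text \<open>Finitely many J carry a coefficient, so a common radius exists. Stating it for all
  larger radii allows it to be matched with that of the bump.\<close>

lemma rform_weight_zero:
  assumes "cform_shift m n s k c"
  shows "\<exists>R0\<ge>0. \<forall>R\<ge>R0. rform m R s k (\<lambda>J. c {} J (\<lambda>_. 0))"
proof -
  let ?u = "\<lambda>J. c {} J (\<lambda>_. 0)"
  have "\<exists>R\<ge>0. \<forall>J\<in>Pow {..<m}. csmooth m R (?u J)"
    using cform_shiftD(1,2)[OF assms] by (intro csmooth_uniform csupp_csmooth) auto
  then obtain R0 where R0: "R0 \<ge> 0" "\<forall>J\<in>Pow {..<m}. csmooth m R0 (?u J)" by blast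
  have deg: "J \<subseteq> {..<m} \<and> card J + s = k" if "?u J \<noteq> (\<lambda>x. 0)" for J
    using cform_shiftD(3)[OF assms that] by (simp add: valid_idx_def fdeg_def)
  have "csmooth m R0 (?u J)" for J
    using R0(2) deg[of J] by (cases "?u J = (\<lambda>x. 0)") (auto simp: csmooth_0)
  then have "rform m R s k ?u" if "R0 \<le> R" for R
    unfolding rform_def using deg csmooth_mono[OF _ that] by blast
  then show ?thesis using R0(1) by blast
qed

lemma cform_decomp:
  assumes "cform_shift m n 0 k w" "dform m n w = (\<lambda>I J b x. 0)"
  shows "w I J b x = dform m n (kosz n w) I J b x + emb (\<lambda>J. w {} J (\<lambda>_. 0)) I J b x"
proof (cases "valid_idx m n I J b")
  case True
  then show ?thesis
    using weight_zero_iff[OF True] dform_kosz[OF assms] by (auto simp: emb_def)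
next
  case False
  then have "w I J b = (\<lambda>x. 0)" using cform_shiftD(3)[OF assms(1)] by blast
  then show ?thesis
    using dform_kosz[OF assms] by (auto simp: emb_def)
qed

section \<open>The cohomology groups\<close>

lemma cform_top_form:
  assumes "smooth m B" "csupp m B"
  shows "cform m n m (top_form m B)"
  using assms by (auto simp: cform_def top_form_def valid_idx_def fdeg_def smooth_const csupp_0)

lemma closed_top_form: "closed_form m n (top_form m B)"
proof -
  have "J - {i} \<noteq> {..<m}" if "i \<in> J" "J \<subseteq> {..<m}" for i J
    using that by blast
  then show ?thesis
    unfolding closed_form_def
    by (intro ext) (auto simp: dform_def top_form_def partial_const valid_idx_def intro!: sum.neutral)
qed

text \<open>The number r is the integral of the top coefficient of the restriction to R^m, which is
  0 by degree unless k = m. Subtracting r B makes the total integral 0, and the primitive is the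
  Koszul primitive plus the pullback of one on R^m.\<close>

lemma exact_up_to_top_form:
  assumes B: "smooth m B" "csupp m B" "integral_Rm m B = 1"
    and w: "cform m n k w" "closed_form m n w"
  shows "\<exists>r. (k \<noteq> m \<longrightarrow> r = 0) \<and> exact_form m n k (\<lambda>I J b x. w I J b x - r * top_form m B I J b x)"
proof -
  define u where "u J = w {} J (\<lambda>_. 0)" for J
  have w': "cform_shift m n 0 k w" "dform m n w = (\<lambda>I J b x. 0)"
    using w by (simp_all add: cform_iff_shift closed_form_def)
  obtain R0 where R0: "\<And>R. R0 \<le> R \<Longrightarrow> rform m R 0 k u"
    using rform_weight_zero[OF w'(1)] unfolding u_def by blast
  obtain R1 where R1: "csmooth m R1 B"
    using csupp_csmooth[OF B(1,2)] by blast
  define R where "R = max 0 (max R0 R1)"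
  have u: "rform m R 0 k u" and BR: "csmooth m R B"
    using R0 csmooth_mono[OF R1] by (auto simp: R_def)
  interpret bumps m R "\<lambda>i. iint R (removeAll i (rev [0..<m])) B"
    by (rule bumps_of_form[OF _ BR B(3)]) (simp add: R_def)
  define r where "r = integral_Rm m (u {..<m})"
  define t where "t J = (if J = {..<m} then B else (\<lambda>x. 0))" for J
  define v where "v J x = u J x - r * t J x" for J x
  have r0: "r = 0" if "k \<noteq> m"
  proof -
    have "u {..<m} = (\<lambda>x. 0)"
      using rformD(3)[OF u, of "{..<m}"] that by auto
    then show ?thesis by (simp add: r_def integral_Rm_def)
  qed
  have iintR: "iint R (rev [0..<m]) f x = integral_Rm m f" if f: "csmooth m R f" for f x
  proof -
    have "iint R (rev [0..<m]) f x = iint R (rev [0..<m]) f (\<lambda>_. 0)"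
    proof (rule eq_at_zero)
      show "iint R (rev [0..<m]) f (trunc m x) = iint R (rev [0..<m]) f x" for x
        by (rule smooth_trunc[OF smooth_iint[OF _ csmoothD(1)[OF f]]]) auto
    qed (rule iint_indep, auto)
    then show ?thesis
      using integral_Rm_eq_iint[of f m R] smooth_continuous[OF csmoothD(1)[OF f]] csmoothD(2)[OF f]
      by simp
  qed
  have sv: "csmooth m R (v J)" for J
  proof -
    have "csmooth m R (t J)" using BR by (simp add: t_def csmooth_0)
    then show ?thesis
      using csmooth_add[OF rformD(1)[OF u, of J] csmooth_cmult[of m R "t J" "- r"]]
      by (simp add: v_def[abs_def])
  qed
  have v: "rform m R 0 k v"
    unfolding rform_def
  proof (intro allI conjI impI sv)
    fix J assume "v J \<noteq> (\<lambda>x. 0)"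
    then have "u J \<noteq> (\<lambda>x. 0) \<or> r \<noteq> 0 \<and> J = {..<m}"
      by (auto simp: v_def[abs_def] t_def split: if_splits)
    then show "J \<subseteq> {..<m}" "card J + 0 = k"
      using rformD(3)[OF u, of J] r0 by auto
  qed
  have "rd m v = (\<lambda>J x. 0)"
  proof (intro ext)
    fix J x
    have "partial i (v (J - {i})) x = partial i (u (J - {i})) x" if "i \<in> J" "J \<subseteq> {..<m}" for i
    proof -
      have "J - {i} \<noteq> {..<m}" using that by blast
      then have "v (J - {i}) = u (J - {i})" by (simp add: v_def[abs_def] t_def)
      then show ?thesis by simp
    qed
    then have "rd m v J x = rd m u J x"
      by (simp add: rd_def)
    then show "rd m v J x = 0"
      using rd_weight_zero[of m w J x n] w'(2) by (simp add: u_def[abs_def])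
  qed
  moreover have "iint R (rev [0..<m]) (v {..<m}) = (\<lambda>x. 0)"
  proof
    fix x
    \<comment> \<open>Indexing by truth values writes the difference as a finite linear combination,
      the shape \<open>iint_lincomb\<close> expects.\<close>
    have "v {..<m} = (\<lambda>x. \<Sum>a\<in>{True, False}. (if a then 1 else - r) * (if a then u {..<m} else B) x)"
      by (simp add: v_def[abs_def] t_def)
    then have "iint R (rev [0..<m]) (v {..<m}) =
      (\<lambda>x. \<Sum>a\<in>{True, False}. (if a then 1 else - r) * iint R (rev [0..<m]) (if a then u {..<m} else B) x)"
      using rformD(2)[OF u] B(1) by (simp only:) (intro iint_lincomb, auto)
    then show "iint R (rev [0..<m]) (v {..<m}) x = 0"
      using iintR[OF BR] iintR[OF rformD(1)[OF u]] B(3) by (simp add: r_def)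
  qed
  moreover have "{..<m} - set (rev [0..<m]) = {}" by auto
  ultimately obtain q where q: "rform m R 1 k q" "rd m q = v"
    using rexact[of "rev [0..<m]" k v] v by (auto simp: atLeast0LessThan)
  have cf: "cform_shift m n 1 k (\<lambda>I J b x. kosz n w I J b x + emb q I J b x)"
    by (intro cform_shift_add cform_kosz w' cform_emb[OF q(1)])
  have "dform m n (\<lambda>I J b x. kosz n w I J b x + emb q I J b x) =
      (\<lambda>I J b x. w I J b x - r * top_form m B I J b x)"
  proof (intro ext)
    fix I J b x
    have "emb v I J b x = emb u I J b x - r * top_form m B I J b x"
      by (simp add: emb_def v_def t_def top_form_def)
    then show "dform m n (\<lambda>I J b x. kosz n w I J b x + emb q I J b x) I J b x =
        w I J b x - r * top_form m B I J b x"
      using cform_decomp[OF w', of I J b x] q(2)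
      by (simp add: dform_add[OF cform_kosz[OF w'(1)] cform_emb[OF q(1)]] dform_emb u_def[abs_def])
  qed
  then show ?thesis
    using exact_formI[OF cf] r0 by blast
qed

text \<open>Only the part of a primitive free of theta and dtheta reaches the top component, so
  \<open>B\<close> would be a signed sum of derivatives of compactly supported functions and have
  integral 0. In degree 0 exactness means \<open>B\<close> = 0, with the same contradiction.\<close>

lemma not_exact_top_form:
  assumes B: "smooth m B" "csupp m B" "integral_Rm m B = 1"
  shows "\<not> exact_form m n m (top_form m B)"
proof
  assume "exact_form m n m (top_form m B)"
  then consider "top_form m B = (\<lambda>I J b x. 0)"
    | e where "0 < m" "cform m n (m - 1) e" "dform m n e = top_form m B"
    by (auto simp: exact_form_def)
  then show False
  proof cases
    case 1
    then have "top_form m B {} {..<m} (\<lambda>_. 0) = (\<lambda>x. 0)" by simp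
    then have "B = (\<lambda>x. 0)" by (simp add: top_form_def)
    with B(3) show False by (simp add: integral_Rm_def)
  next
    case 2
    define u where "u J = e {} J (\<lambda>_. 0)" for J
    have e: "cform_shift m n 0 (m - 1) e" using 2 by (simp add: cform_iff_shift)
    obtain R0 where R0: "\<And>R. R0 \<le> R \<Longrightarrow> rform m R 0 (m - 1) u"
      using rform_weight_zero[OF e] unfolding u_def by blast
    obtain R1 where R1: "csmooth m R1 B"
      using csupp_csmooth[OF B(1,2)] by blast
    define R where "R = max R0 R1"
    have u: "rform m R 0 (m - 1) u" and BR: "csmooth m R B"
      using R0 csmooth_mono[OF R1] by (auto simp: R_def)
    have "rd m u {..<m} x = B x" for x
      using rd_weight_zero[of m e "{..<m}" x n] 2(3) by (simp add: u_def[abs_def] top_form_def)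
    then have "B = (\<lambda>x. \<Sum>i<m. ksgn {..<m} i * partial i (u ({..<m} - {i})) x)"
      by (simp add: rd_def fun_eq_iff)
    then have "iint R (rev [0..<m]) B =
        iint R (rev [0..<m]) (\<lambda>x. \<Sum>i<m. ksgn {..<m} i * partial i (u ({..<m} - {i})) x)"
      by simp
    also have "\<dots> =
        (\<lambda>x. \<Sum>i<m. ksgn {..<m} i * iint R (rev [0..<m]) (partial i (u ({..<m} - {i}))) x)"
      using rformD(2)[OF u] by (intro iint_lincomb[of _ m] smooth_partial) auto
    also have "\<dots> = (\<lambda>x. 0)"
    proof (intro ext sum.neutral ballI)
      fix x i assume "i \<in> {..<m}"
      then have "iint R (rev [0..<m]) (partial i (u ({..<m} - {i}))) = (\<lambda>x. 0)"
        using rformD(2)[OF u] csmoothD(2)[OF rformD(1)[OF u]] by (intro iint_partial[of _ m]) auto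
      then show "ksgn {..<m} i * iint R (rev [0..<m]) (partial i (u ({..<m} - {i}))) x = 0"
        by simp
    qed
    finally have "iint R (rev [0..<m]) B (\<lambda>_. 0) = 0" by simp
    moreover have "integral_Rm m B = iint R (rev [0..<m]) B (\<lambda>_. 0)"
      using csmoothD[OF BR] by (intro integral_Rm_eq_iint smooth_continuous)
    ultimately show False using B(3) by simp
  qed
qed

text \<open>The groups are described without forming quotients: in degree m the class of
  \<open>B\<close> is nonzero and every class is a real multiple of it, which makes the group
  one-dimensional.\<close>

theorem mainTheorem3:
  fixes m n k :: nat and B :: "(nat \<Rightarrow> real) \<Rightarrow> real"
  assumes "smooth m B" and "csupp m B" and "integral_Rm m B = 1"
  shows "(k \<noteq> m \<longrightarrow> (\<forall>w. cform m n k w \<and> closed_form m n w \<longrightarrow> exact_form m n k w))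
       \<and> (k = m \<longrightarrow>
            cform m n m (top_form m B) \<and> closed_form m n (top_form m B)
          \<and> \<not> exact_form m n m (top_form m B)
          \<and> (\<forall>w. cform m n m w \<and> closed_form m n w \<longrightarrow>
                 (\<exists>r::real. exact_form m n m (\<lambda>I J b x. w I J b x - r * top_form m B I J b x))))"
proof (intro conjI impI allI)
  fix w assume "k \<noteq> m" "cform m n k w \<and> closed_form m n w"
  then show "exact_form m n k w"
    using exact_up_to_top_form[OF assms, of n k w] by auto
next
  fix w assume "cform m n m w \<and> closed_form m n w"
  then show "\<exists>r. exact_form m n m (\<lambda>I J b x. w I J b x - r * top_form m B I J b x)"
    using exact_up_to_top_form[OF assms, of n m w] by blast
qed (intro cform_top_form closed_top_form not_exact_top_form assms)+

end
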